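(* A map between smooth manifolds is a diffeological immersion (the manifolds being equipped with their standard diffeologies) if and only if it is an immersion of manifolds in the usual sense.
   Context: An $n$-domain is an open subset of $\mathbb{R}^n$; a domain is an $n$-domain for some $n\ge 0$. A parametrization in a set $X$ is a map from a domain to $X$. A diffeology on $X$ is a set $\mathcal{D}$ of parametrizations in $X$ such that: (D1) the images of the elements of $\mathcal{D}$ cover $X$; (D2) $P\circ F\in\mathcal{D}$ for every $P:U\to X$ in $\mathcal{D}$ and every smooth map $F:V\to U$ between domains; (D3) if a family of $n$-parametrizations $P_i:U_i\to X$ in $\mathcal{D}$ agree on overlaps, their common extension to $\bigcup_i U_i$ is in $\mathcal{D}$. A diffeological space is a set with a diffeology, whose elements are called plots. A map $f:X\to Y$ is smooth if $f\circ P$ is a plot in $Y$ for every plot $P$ in $X$. A subset of $X$ is D-open if its preimage under every plot is open. Subsets carry the subspace diffeology (plots with values in the subset), and the plots of a product are the tuples of plots. The standard diffeology of a manifold (or domain) consists of its usual smooth parametrizations. For smooth maps $f:X\to Y$ and $g:Z\to Y$, the pullback of $f$ by $g$ is $g^*f:g^*X\to Z$, $(z,x)\mapsto z$, where $g^*X=\{(z,x)\in Z\times X: g(z)=f(x)\}$. Diffeological immersion: a smooth map $f:X\to Y$ such that for every plot $P:U\to Y$ and every $(r_0,x_0)\in P^*X$ there exist a D-open neighborhood $O$ of $(r_0,x_0)$ in $P^*X$, an open neighborhood $V\subseteq U$ of $P^*f(O)$ and a smooth map $\varrho:V\to U\times X$ such that $\varrho\circ P^*f(r,x)=(r,x)$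 for all $(r,x)\in O$. *)

theory Defs
  imports "HOL-Analysis.Analysis"
begin

section \<open>Smooth maps between domains\<close>

text \<open>
  The dimension of a domain is a variable in the definition of a diffeology, so \<open>R^n\<close> is
  \<^term>\<open>Euclidean_space n\<close>: sequences of reals that vanish from index \<open>n\<close> on, with the
  Euclidean topology.
\<close>

definition domain :: "nat \<Rightarrow> (nat \<Rightarrow> real) set \<Rightarrow> bool"
  where "domain n U \<longleftrightarrow> openin (Euclidean_space n) U"

definition partial :: "nat \<Rightarrow> ((nat \<Rightarrow> real) \<Rightarrow> real) \<Rightarrow> (nat \<Rightarrow> real) \<Rightarrow> real"
  where "partial i g x = deriv (\<lambda>t. g (x(i := t))) (x i)"

text \<open>
  All iterated partial derivatives exist and are continuous on the open set \<open>U\<close>. Since \<open>U\<close> is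
  open, the values of \<open>g\<close> outside of \<open>U\<close> do not matter.
\<close>

definition smooth_fun :: "nat \<Rightarrow> (nat \<Rightarrow> real) set \<Rightarrow> ((nat \<Rightarrow> real) \<Rightarrow> real) \<Rightarrow> bool"
  where "smooth_fun n U g \<longleftrightarrow>
    (\<forall>is. set is \<subseteq> {..<n} \<longrightarrow>
       continuous_map (subtopology (Euclidean_space n) U) euclideanreal (foldr partial is g) \<and>
       (\<forall>i<n. \<forall>x\<in>U. (\<lambda>t. foldr partial is g (x(i := t))) differentiable (at (x i))))"

definition smooth_map ::
    "nat \<Rightarrow> (nat \<Rightarrow> real) set \<Rightarrow> nat \<Rightarrow> ((nat \<Rightarrow> real) \<Rightarrow> nat \<Rightarrow> real) \<Rightarrow> bool"
  where "smooth_map m U n F \<longleftrightarrow>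
    F \<in> U \<rightarrow> topspace (Euclidean_space n) \<and> (\<forall>j<n. smooth_fun m U (\<lambda>x. F x j))"

text \<open>The Jacobian matrix of \<open>F\<close> at \<open>x\<close>, as a linear map from \<open>R^m\<close> to \<open>R^n\<close>.\<close>

definition jacobian ::
    "nat \<Rightarrow> nat \<Rightarrow> ((nat \<Rightarrow> real) \<Rightarrow> nat \<Rightarrow> real) \<Rightarrow> (nat \<Rightarrow> real) \<Rightarrow> (nat \<Rightarrow> real) \<Rightarrow> nat \<Rightarrow> real"
  where "jacobian m n F x v =
    (\<lambda>j. if j < n then \<Sum>i<m. partial i (\<lambda>y. F y j) x * v i else 0)"


section \<open>Smooth manifolds\<close>

text \<open>A chart is a pair of an open set and a coordinate map, of which only the values on that
  open set are relevant.\<close>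

type_synonym 'a chart = "'a set \<times> ('a \<Rightarrow> nat \<Rightarrow> real)"

record 'a manifold =
  mdim :: nat
  mtop :: "'a topology"
  atlas :: "'a chart set"

definition local_rep ::
    "'a chart \<Rightarrow> 'b chart \<Rightarrow> ('a \<Rightarrow> 'b) \<Rightarrow> (nat \<Rightarrow> real) \<Rightarrow> nat \<Rightarrow> real"
  where "local_rep c d f y = snd d (f (inv_into (fst c) (snd c) y))"

definition local_dom :: "'a chart \<Rightarrow> 'b chart \<Rightarrow> ('a \<Rightarrow> 'b) \<Rightarrow> (nat \<Rightarrow> real) set"
  where "local_dom c d f = snd c ` {p \<in> fst c. f p \<in> fst d}"

text \<open>The atlas is not required to be maximal; the notions below do not change when it is
  enlarged to the maximal one.\<close>

definition smooth_manifold :: "'a manifold \<Rightarrow> bool"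
  where "smooth_manifold M \<longleftrightarrow>
    Hausdorff_space (mtop M) \<and> second_countable (mtop M) \<and>
    (\<Union>c\<in>atlas M. fst c) = topspace (mtop M) \<and>
    (\<forall>(U, \<phi>)\<in>atlas M.
       openin (mtop M) U \<and> domain (mdim M) (\<phi> ` U) \<and>
       homeomorphic_map (subtopology (mtop M) U)
         (subtopology (Euclidean_space (mdim M)) (\<phi> ` U)) \<phi>) \<and>
    (\<forall>c\<in>atlas M. \<forall>d\<in>atlas M.
       smooth_map (mdim M) (local_dom c d (\<lambda>p. p)) (mdim M) (local_rep c d (\<lambda>p. p)))"

definition smooth_manifold_map :: "'a manifold \<Rightarrow> 'b manifold \<Rightarrow> ('a \<Rightarrow> 'b) \<Rightarrow> bool"
  where "smooth_manifold_map M N f \<longleftrightarrow>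
    continuous_map (mtop M) (mtop N) f \<and>
    (\<forall>c\<in>atlas M. \<forall>d\<in>atlas N.
       smooth_map (mdim M) (local_dom c d f) (mdim N) (local_rep c d f))"

definition domain_manifold :: "nat \<Rightarrow> (nat \<Rightarrow> real) set \<Rightarrow> (nat \<Rightarrow> real) manifold"
  where "domain_manifold n U =
    \<lparr>mdim = n, mtop = subtopology (Euclidean_space n) U, atlas = {(U, \<lambda>x. x)}\<rparr>"

definition charts_at :: "'a manifold \<Rightarrow> 'a \<Rightarrow> 'a chart set"
  where "charts_at M p = {c \<in> atlas M. p \<in> fst c}"

text \<open>
  A tangent vector at \<open>p\<close> is given by its coordinate vectors in all charts at \<open>p\<close>, which are
  related by the Jacobian matrices of the transition maps.
\<close>

definition tangent_space :: "'a manifold \<Rightarrow> 'a \<Rightarrow> ('a chart \<Rightarrow> nat \<Rightarrow> real) set"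
  where "tangent_space M p =
    {X \<in> charts_at M p \<rightarrow>\<^sub>E topspace (Euclidean_space (mdim M)).
       \<forall>c\<in>charts_at M p. \<forall>d\<in>charts_at M p.
         X d = jacobian (mdim M) (mdim M) (local_rep c d (\<lambda>p. p)) (snd c p) (X c)}"

text \<open>The choice of the chart \<open>c\<close> at \<open>p\<close> is immaterial, by the chain rule.\<close>

definition differential ::
    "'a manifold \<Rightarrow> 'b manifold \<Rightarrow> ('a \<Rightarrow> 'b) \<Rightarrow> 'a \<Rightarrow> ('a chart \<Rightarrow> nat \<Rightarrow> real) \<Rightarrow>
     'b chart \<Rightarrow> nat \<Rightarrow> real"
  where "differential M N f p X =
    (\<lambda>d\<in>charts_at N (f p).
       let c = (SOME c. c \<in> charts_at M p)
       in jacobian (mdim M) (mdim N) (local_rep c d f) (snd c p) (X c))"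

definition manifold_immersion :: "'a manifold \<Rightarrow> 'b manifold \<Rightarrow> ('a \<Rightarrow> 'b) \<Rightarrow> bool"
  where "manifold_immersion M N f \<longleftrightarrow>
    smooth_manifold_map M N f \<and>
    (\<forall>p\<in>topspace (mtop M). inj_on (differential M N f p) (tangent_space M p))"


section \<open>Diffeological spaces\<close>

text \<open>
  The triple \<open>(n, U, P)\<close> stands for the \<open>n\<close>-parametrization \<open>P\<close> with domain \<open>U\<close>. Maps on \<open>U\<close>
  are represented by functions that are \<^term>\<open>undefined\<close> outside of \<open>U\<close>.
\<close>

type_synonym 'a parametrization = "nat \<times> (nat \<Rightarrow> real) set \<times> ((nat \<Rightarrow> real) \<Rightarrow> 'a)"

definition parametrizations :: "'a set \<Rightarrow> 'a parametrization set"
  where "parametrizations X = {(n, U, P). domain n U \<and> P \<in> U \<rightarrow>\<^sub>E X}"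

record 'a dspace =
  points :: "'a set"
  plots :: "'a parametrization set"

definition diffeological_space :: "'a dspace \<Rightarrow> bool"
  where "diffeological_space X \<longleftrightarrow>
    plots X \<subseteq> parametrizations (points X) \<and>
    (\<Union>(n, U, P)\<in>plots X. P ` U) = points X \<and>
    (\<forall>(n, U, P)\<in>plots X. \<forall>m V F.
       domain m V \<and> F \<in> V \<rightarrow> U \<and> smooth_map m V n F \<longrightarrow> (m, V, compose V P F) \<in> plots X) \<and>
    (\<forall>n \<F>. (\<forall>(U, P)\<in>\<F>. (n, U, P) \<in> plots X) \<and>
        (\<forall>(U, P)\<in>\<F>. \<forall>(V, Q)\<in>\<F>. \<forall>x\<in>U \<inter> V. P x = Q x) \<longrightarrow>
        (\<forall>W R. W = (\<Union>(U, P)\<in>\<F>. U) \<and> R \<in> W \<rightarrow>\<^sub>E points X \<and> (\<forall>(U, P)\<in>\<F>. \<forall>x\<in>U. R x = P x) \<longrightarrow>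
           (n, W, R) \<in> plots X))"

definition dsmooth :: "'a dspace \<Rightarrow> 'b dspace \<Rightarrow> ('a \<Rightarrow> 'b) \<Rightarrow> bool"
  where "dsmooth X Y f \<longleftrightarrow>
    f \<in> points X \<rightarrow> points Y \<and>
    (\<forall>(n, U, P)\<in>plots X. (n, U, compose U f P) \<in> plots Y)"

definition dopen :: "'a dspace \<Rightarrow> 'a set \<Rightarrow> bool"
  where "dopen X S \<longleftrightarrow>
    S \<subseteq> points X \<and> (\<forall>(n, U, P)\<in>plots X. openin (Euclidean_space n) {x \<in> U. P x \<in> S})"

definition subspace_diff :: "'a dspace \<Rightarrow> 'a set \<Rightarrow> 'a dspace"
  where "subspace_diff X S =
    \<lparr>points = S, plots = {(n, U, P). (n, U, P) \<in> plots X \<and> P ` U \<subseteq> S}\<rparr>"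

definition product_diff :: "'a dspace \<Rightarrow> 'b dspace \<Rightarrow> ('a \<times> 'b) dspace"
  where "product_diff X Y =
    \<lparr>points = points X \<times> points Y,
     plots = {(n, U, P). (n, U, P) \<in> parametrizations (points X \<times> points Y) \<and>
       (n, U, compose U fst P) \<in> plots X \<and> (n, U, compose U snd P) \<in> plots Y}\<rparr>"

definition standard_diff :: "'a manifold \<Rightarrow> 'a dspace"
  where "standard_diff M =
    \<lparr>points = topspace (mtop M),
     plots = {(n, U, P). (n, U, P) \<in> parametrizations (topspace (mtop M)) \<and>
       smooth_manifold_map (domain_manifold n U) M P}\<rparr>"

definition domain_diff :: "nat \<Rightarrow> (nat \<Rightarrow> real) set \<Rightarrow> (nat \<Rightarrow> real) dspace"
  where "domain_diff n U = standard_diff (domain_manifold n U)"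

text \<open>The pullback \<open>g\<^sup>*X\<close> of \<open>f : X \<rightarrow> Y\<close> by \<open>g : Z \<rightarrow> Y\<close>; the pulled back map
  \<open>g\<^sup>*f : g\<^sup>*X \<rightarrow> Z\<close> is \<^term>\<open>fst\<close>.\<close>

definition pullback :: "'c dspace \<Rightarrow> ('c \<Rightarrow> 'b) \<Rightarrow> 'a dspace \<Rightarrow> ('a \<Rightarrow> 'b) \<Rightarrow> ('c \<times> 'a) dspace"
  where "pullback Z g X f =
    subspace_diff (product_diff Z X) {(z, x). z \<in> points Z \<and> x \<in> points X \<and> g z = f x}"

definition diffeological_immersion :: "'a dspace \<Rightarrow> 'b dspace \<Rightarrow> ('a \<Rightarrow> 'b) \<Rightarrow> bool"
  where "diffeological_immersion X Y f \<longleftrightarrow>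
    diffeological_space X \<and> diffeological_space Y \<and> dsmooth X Y f \<and>
    (\<forall>(n, U, P)\<in>plots Y. \<forall>(r0, x0)\<in>points (pullback (domain_diff n U) P X f).
       \<exists>S V \<rho>.
         dopen (pullback (domain_diff n U) P X f) S \<and> (r0, x0) \<in> S \<and>
         domain n V \<and> V \<subseteq> U \<and> fst ` S \<subseteq> V \<and>
         dsmooth (domain_diff n V) (product_diff (domain_diff n U) X) \<rho> \<and>
         (\<forall>(r, x)\<in>S. \<rho> (fst (r, x)) = (r, x)))"

end

(*
  In charts, the theorem reduces to a local statement. If f is an immersion, it has smooth local
  left inverses g, and for a plot P with P(r0) = f(x0) the map r |-> (r, g(P(r))) is the required
  section. Conversely, the definition of a diffeological immersion, applied to an inverse chart of
  N as plot, yields a smooth local left inverse of f, so the differential of f is injective by the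
  chain rule.

  The left inverse of an immersion F is built without linear algebra: some entry of column j of
  the Jacobian matrix of F is nonzero, say that of the component F_q, so x |-> x(j := F_q x) is a
  local change of coordinates, and after it the component F_q of F is the coordinate j. Once this
  has been done for every j, a linear projection is a left inverse.
*)

theory Submission
  imports "HOL-Homology.Invariance_of_Domain" Defs
begin

section \<open>Open subsets of Euclidean space\<close>

text \<open>As the dimension is a variable, \<open>R^n\<close> sits inside the sequences of reals
  with the product topology, a space that is not normable. All calculus is therefore done along
  coordinate lines, with partial derivatives and the mean value theorem of one variable. This is why
  coordinates are straightened one at a time: a map that alters a single coordinate is injective as
  soon as one partial derivative has no zero. Smoothness consists of infinitely many conditions and
  is proved by coinduction: one exhibits a set of continuous functions whose partial derivatives
  agree on the domain with members of the set. Reciprocals, composites and inverse maps differ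
  mainly in the set exhibited. On the diffeological side, a section may take values outside the
  pullback, as it must where the plot leaves the image of the map. In the converse direction,
  D-openness can be exploited only through a plot of the pullback; the graph of \<open>f\<close>
  over a chart is one.\<close>

abbreviation Rn :: "nat \<Rightarrow> (nat \<Rightarrow> real) set" where "Rn n \<equiv> topspace (Euclidean_space n)"

lemma mem_Rn: "x \<in> Rn n \<longleftrightarrow> (\<forall>i\<ge>n. x i = 0)"
  by (simp add: topspace_Euclidean_space)

lemma fun_upd_mem_Rn: "x \<in> Rn n \<Longrightarrow> i < n \<Longrightarrow> x(i := t) \<in> Rn n"
  by (auto simp: mem_Rn)

lemma Euclidean_space_eq_top_of_set: "Euclidean_space n = top_of_set {x. \<forall>i\<ge>n. x i = 0}"
  by (simp add: Euclidean_space_def euclidean_product_topology)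

lemma domain_iff_open: "domain n U \<longleftrightarrow> (\<exists>T. open T \<and> U = Rn n \<inter> T)"
  unfolding domain_def topspace_Euclidean_space Euclidean_space_eq_top_of_set openin_open by simp

lemma domain_subset: "domain n U \<Longrightarrow> U \<subseteq> Rn n"
  by (auto simp: domain_iff_open)

lemma domain_Int: "domain n U \<Longrightarrow> domain n V \<Longrightarrow> domain n (U \<inter> V)"
  by (simp add: domain_def openin_Int)

lemma domain_UN: "(\<And>i. i \<in> I \<Longrightarrow> domain n (U i)) \<Longrightarrow> domain n (\<Union>i\<in>I. U i)"
  by (auto simp: domain_def)

lemma domain_Rn: "domain n (Rn n)"
  by (simp add: domain_def)

lemma domain_preimage_open:
  assumes "domain n U" "continuous_on U F" "open T"
  shows "domain n {x \<in> U. F x \<in> T}"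
proof -
  obtain S where S: "open S" "U = Rn n \<inter> S" using assms(1) by (auto simp: domain_iff_open)
  obtain R where R: "open R" "R \<inter> U = F -` T \<inter> U"
    using assms(2,3) unfolding continuous_on_open_invariant by blast
  have "{x \<in> U. F x \<in> T} = F -` T \<inter> U" by auto
  also have "\<dots> = R \<inter> U" using R(2) by simp
  also have "\<dots> = Rn n \<inter> (R \<inter> S)" unfolding S(2) by blast
  finally show ?thesis using open_Int[OF R(1) S(1)] unfolding domain_iff_open by blast
qed

lemma domain_preimage:
  assumes "domain n U" "continuous_on U F" "F \<in> U \<rightarrow> Rn m" "domain m V"
  shows "domain n {x \<in> U. F x \<in> V}"
proof -
  obtain T where T: "open T" "V = Rn m \<inter> T" using assms(4) by (auto simp: domain_iff_open)
  have "{x \<in> U. F x \<in> V} = {x \<in> U. F x \<in> T}"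
    using T(2) assms(3) by blast
  then show ?thesis using domain_preimage_open[OF assms(1,2) T(1)] by simp
qed

section \<open>Cubes as neighbourhoods\<close>

definition box_at :: "nat \<Rightarrow> (nat \<Rightarrow> real) \<Rightarrow> real \<Rightarrow> (nat \<Rightarrow> real) set"
  where "box_at n x \<delta> = {y \<in> Rn n. \<forall>i<n. \<bar>y i - x i\<bar> < \<delta>}"

lemma domain_box_at: "domain n (box_at n x \<delta>)"
proof -
  have "open {y :: nat \<Rightarrow> real. \<forall>i\<in>{..<n}. y (id i) \<in> ball (x i) \<delta>}"
    by (rule product_topology_basis') auto
  moreover have "box_at n x \<delta> = Rn n \<inter> {y :: nat \<Rightarrow> real. \<forall>i\<in>{..<n}. y (id i) \<in> ball (x i) \<delta>}"
    by (auto simp: box_at_def dist_real_def abs_minus_commute)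
  ultimately show ?thesis unfolding domain_iff_open by blast
qed

text \<open>From index \<open>n\<close> on, all points of \<open>Rn n\<close> agree with
  \<open>x\<close>, so only the first \<open>n\<close> factors of a basic open set restrict the
  radius. Cubes are preferred to balls because coordinates can be moved independently inside
  them.\<close>

lemma domain_contains_box:
  assumes "domain n U" "x \<in> U"
  obtains \<delta> where "\<delta> > 0" "box_at n x \<delta> \<subseteq> U"
proof -
  obtain T where T: "open T" "U = Rn n \<inter> T" using assms by (auto simp: domain_iff_open)
  have "openin (product_topology (\<lambda>i. euclidean) UNIV) T"
    using T(1) by (simp add: euclidean_product_topology)
  from product_topology_open_contains_basis[OF this] T(2) assms(2)
  obtain X where X: "x \<in> (\<Pi>\<^sub>E i\<in>UNIV. X i)" "\<And>i. open (X i)" "(\<Pi>\<^sub>E i\<in>UNIV. X i) \<subseteq> T"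
    by auto metis
  have "\<exists>d>0. ball (x i) d \<subseteq> X i" for i
    using X(1) X(2)[of i] by (meson PiE_mem UNIV_I open_contains_ball)
  then obtain d where d: "\<And>i. d i > 0" "\<And>i. ball (x i) (d i) \<subseteq> X i" by metis
  \<comment> \<open>The inserted 1 keeps the minimum defined when \<open>n = 0\<close>.\<close>
  define \<delta> where "\<delta> = Min (insert 1 (d ` {..<n}))"
  have \<delta>: "\<delta> > 0" "\<And>i. i < n \<Longrightarrow> \<delta> \<le> d i"
    using d(1) by (auto simp: \<delta>_def)
  have "y \<in> U" if "y \<in> box_at n x \<delta>" for y
  proof -
    have "y i \<in> X i" for i
    proof (cases "i < n")
      case True
      then have "\<bar>y i - x i\<bar> < d i" using that \<delta>(2)[OF True] by (force simp: box_at_def)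
      then show ?thesis using d(2)[of i] by (auto simp: dist_real_def abs_minus_commute)
    next
      case False
      then have "y i = x i" using that assms(2) T(2) by (auto simp: box_at_def mem_Rn)
      then show ?thesis using X(1) by auto
    qed
    then show ?thesis using X(3) T(2) that by (auto simp: box_at_def)
  qed
  then show thesis using that[of \<delta>] \<delta>(1) by blast
qed

text \<open>This makes a derivative along a coordinate line at a point of \<open>U\<close> depend
  only on the values in \<open>U\<close>.\<close>

lemma eventually_fun_upd_mem:
  assumes "domain n U" "x \<in> U" "i < n"
  shows "eventually (\<lambda>t. x(i := t) \<in> U) (nhds (x i))"
proof -
  obtain \<delta> where d: "\<delta> > 0" "box_at n x \<delta> \<subseteq> U" using domain_contains_box assms by metis
  have "x(i := t) \<in> U" if "dist t (x i) < \<delta>" for t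
    using that d assms domain_subset[OF assms(1)] fun_upd_mem_Rn[of x n i t]
    by (intro set_mp[OF d(2)]) (auto simp: box_at_def dist_real_def)
  then show ?thesis using d(1) eventually_nhds_metric by blast
qed

text \<open>The right-hand side does not mention \<open>U\<close>: continuity on a domain becomes a
  pointwise condition that can be carried from one domain to another.\<close>

lemma at_within_domain:
  assumes "domain n U" "x \<in> U"
  shows "at x within U = at x within Rn n"
proof -
  obtain T where T: "open T" "U = Rn n \<inter> T" using assms by (auto simp: domain_iff_open)
  show ?thesis by (rule at_within_nhd[where S = T]) (use T assms in auto)
qed

lemma continuous_on_domain_iff:
  "domain n U \<Longrightarrow> continuous_on U g \<longleftrightarrow> (\<forall>x\<in>U. continuous (at x within Rn n) g)"
  by (simp add: continuous_on_eq_continuous_within at_within_domain)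

lemma continuous_map_domain_iff:
  assumes "U \<subseteq> Rn n"
  shows "continuous_map (subtopology (Euclidean_space n) U) euclideanreal g \<longleftrightarrow> continuous_on U g"
  using assms unfolding topspace_Euclidean_space
  by (simp add: Euclidean_space_eq_top_of_set subtopology_subtopology inf.absorb2)

lemma continuous_map_domain_Euclidean_iff:
  assumes "U \<subseteq> Rn n"
  shows "continuous_map (subtopology (Euclidean_space n) U) (Euclidean_space m) F \<longleftrightarrow>
    continuous_on U F \<and> F \<in> U \<rightarrow> Rn m"
  using assms by (simp add: cm_Euclidean_space_iff_continuous_on inf.absorb2)

lemma continuous_on_into_Rn:
  assumes "F \<in> U \<rightarrow> Rn m" "\<And>j. j < m \<Longrightarrow> continuous_on U (\<lambda>x. F x j)"
  shows "continuous_on U F"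
proof (rule continuous_on_coordinatewise_then_product)
  fix j show "continuous_on U (\<lambda>x. F x j)"
  proof (cases "j < m")
    case False
    then have "continuous_on U (\<lambda>x. F x j) \<longleftrightarrow> continuous_on U (\<lambda>x. 0::real)"
      using assms(1) by (intro continuous_on_cong) (auto simp: mem_Rn Pi_iff)
    then show ?thesis by simp
  qed (use assms in auto)
qed


section \<open>Smooth functions\<close>

text \<open>\<open>partial\<close> has a value even where no derivative exists; this relation
  asserts existence as well.\<close>

abbreviation partial_deriv ("((_)/ has'_partial (_) (_)/ at (_))" [50, 1000, 1000, 50] 50)
  where "g has_partial i d at x \<equiv> ((\<lambda>t. g (x(i := t))) has_real_derivative d) (at (x i))"

lemma has_partial_cong:
  assumes "domain n U" "x \<in> U" "i < n" "\<And>y. y \<in> U \<Longrightarrow> g y = h y"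
  shows "g has_partial i d at x \<longleftrightarrow> h has_partial i d at x"
proof (rule DERIV_cong_ev)
  show "\<forall>\<^sub>F t in nhds (x i). g (x(i := t)) = h (x(i := t))"
    using eventually_fun_upd_mem[OF assms(1-3)] by eventually_elim (rule assms(4))
qed auto

lemma partial_eqI: "g has_partial i d at x \<Longrightarrow> partial i g x = d"
  unfolding partial_def by (rule DERIV_imp_deriv)

lemma partial_cong:
  assumes "domain n U" "x \<in> U" "i < n" "\<And>y. y \<in> U \<Longrightarrow> g y = h y"
  shows "partial i g x = partial i h x"
  unfolding partial_def deriv_def using has_partial_cong[of n U x i g h] assms by simp

lemma smooth_funD:
  assumes "smooth_fun n U g" "U \<subseteq> Rn n"
  shows smooth_fun_continuous: "continuous_on U g"
    and smooth_fun_has_partial: "i < n \<Longrightarrow> x \<in> U \<Longrightarrow> g has_partial i (partial i g x) at x"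
    and smooth_fun_partial: "i < n \<Longrightarrow> smooth_fun n U (partial i g)"
proof -
  have *: "continuous_map (subtopology (Euclidean_space n) U) euclideanreal (foldr partial is g)"
    "\<And>i x. i < n \<Longrightarrow> x \<in> U \<Longrightarrow> (\<lambda>t. foldr partial is g (x(i := t))) differentiable (at (x i))"
    if "set is \<subseteq> {..<n}" for "is"
    using assms(1) that unfolding smooth_fun_def by blast+
  show "continuous_on U g"
    using *(1)[of "[]"] assms(2) by (simp add: continuous_map_domain_iff)
  show "g has_partial i (partial i g x) at x" if "i < n" "x \<in> U"
    using *(2)[of "[]" i x] that unfolding partial_def
    by (simp add: DERIV_deriv_iff_real_differentiable)
  show "smooth_fun n U (partial i g)" if "i < n"
    unfolding smooth_fun_def
  proof (intro allI impI)
    fix "is" assume "set is \<subseteq> {..<n}"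
    \<comment> \<open>Under \<open>foldr\<close> the last index of the list acts first, so
      differentiating by \<open>i\<close> beforehand means appending \<open>i\<close>.\<close>
    then have "set (is @ [i]) \<subseteq> {..<n}" using that by auto
    from *[OF this]
    show "continuous_map (subtopology (Euclidean_space n) U) euclideanreal (foldr partial is (partial i g)) \<and>
       (\<forall>j<n. \<forall>x\<in>U. (\<lambda>t. foldr partial is (partial i g) (x(j := t))) differentiable (at (x j)))"
      by simp
  qed
qed

text \<open>By induction on the list of indices, every iterated partial derivative of
  \<open>g\<close> agrees on \<open>U\<close> with a member of \<open>R\<close>. Agreement on
  \<open>U\<close> suffices, since \<open>U\<close> is open and a partial derivative there does not
  see values elsewhere.\<close>

lemma smooth_fun_coinduct:
  assumes "domain n U" "g \<in> R"
    and cont: "\<And>g. g \<in> R \<Longrightarrow> continuous_on U g"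
    and step: "\<And>g i. g \<in> R \<Longrightarrow> i < n \<Longrightarrow> \<exists>h\<in>R. \<forall>x\<in>U. g has_partial i (h x) at x"
  shows "smooth_fun n U g"
proof -
  have sub: "U \<subseteq> Rn n" by (rule domain_subset[OF assms(1)])
  have *: "\<exists>h\<in>R. \<forall>x\<in>U. foldr partial is g x = h x" if "set is \<subseteq> {..<n}" for "is"
    using that
  proof (induction "is")
    case Nil then show ?case using assms(2) by auto
  next
    case (Cons i js)
    then obtain h where h: "h \<in> R" "\<And>x. x \<in> U \<Longrightarrow> foldr partial js g x = h x" by auto
    from Cons obtain k where k: "k \<in> R" "\<And>x. x \<in> U \<Longrightarrow> h has_partial i (k x) at x"
      using step[OF h(1), of i] by auto
    have "partial i (foldr partial js g) x = k x" if "x \<in> U" for x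
    proof -
      have "partial i (foldr partial js g) x = partial i h x"
        using Cons(2) by (intro partial_cong[OF assms(1) that _ h(2)]) auto
      then show ?thesis using partial_eqI[OF k(2)[OF that]] by simp
    qed
    then show ?case using k(1) by auto
  qed
  show ?thesis unfolding smooth_fun_def
  proof (intro allI impI conjI ballI)
    fix "is" assume "set is \<subseteq> {..<n}"
    from *[OF this] obtain h where h: "h \<in> R" "\<And>x. x \<in> U \<Longrightarrow> foldr partial is g x = h x" by auto
    have "continuous_on U (foldr partial is g)"
      using cont[OF h(1)] h(2) by (subst continuous_on_cong[OF refl h(2)])
    then show "continuous_map (subtopology (Euclidean_space n) U) euclideanreal (foldr partial is g)"
      using sub by (simp add: continuous_map_domain_iff)
    fix i x assume ix: "i < n" "x \<in> U"
    then obtain k where "h has_partial i k at x" using step[OF h(1), of i] by auto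
    then have "foldr partial is g has_partial i k at x"
      using has_partial_cong[of n U x i "foldr partial is g" h] assms(1) ix h(2) by simp
    then show "(\<lambda>t. foldr partial is g (x(i := t))) differentiable (at (x i))"
      using real_differentiable_def by blast
  qed
qed

text \<open>Off \<open>U\<close> the iterated partial derivatives of \<open>g\<close> and
  \<open>h\<close> may differ. Adding \<open>h\<close> to the smooth functions gives a set that is
  still closed under partial derivatives on \<open>U\<close>.\<close>

lemma smooth_fun_cong:
  assumes "domain n U" "\<And>x. x \<in> U \<Longrightarrow> g x = h x" "smooth_fun n U g"
  shows "smooth_fun n U h"
proof (rule smooth_fun_coinduct[OF assms(1)])
  let ?R = "insert h {g. smooth_fun n U g}"
  note sub = domain_subset[OF assms(1)]
  show "h \<in> ?R" by simp
  fix k assume k: "k \<in> ?R"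
  have *: "\<exists>k'. smooth_fun n U k' \<and> (\<forall>x\<in>U. k x = k' x)"
  proof (cases "k = h")
    case True then show ?thesis using assms(2,3) by (intro exI[of _ g]) auto
  qed (use k in auto)
  then obtain k' where k': "smooth_fun n U k'" "\<And>x. x \<in> U \<Longrightarrow> k x = k' x" by auto
  show "continuous_on U k"
    using smooth_fun_continuous[OF k'(1) sub] k'(2) by (subst continuous_on_cong[OF refl k'(2)]) auto
  fix i assume i: "i < n"
  show "\<exists>h\<in>?R. \<forall>x\<in>U. k has_partial i (h x) at x"
    using smooth_fun_partial[OF k'(1) sub i] smooth_fun_has_partial[OF k'(1) sub i]
      has_partial_cong[of n U _ i k k'] assms(1) i k'(2) by (intro bexI[of _ "partial i k'"]) auto
qed

text \<open>The iterated partial derivatives are the same total functions for every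
  \<open>W\<close>, so both conditions in \<open>smooth_fun\<close> can be checked near each
  point.\<close>

lemma smooth_fun_local:
  assumes "domain n U"
    and "\<And>x. x \<in> U \<Longrightarrow> \<exists>W. domain n W \<and> x \<in> W \<and> smooth_fun n W g"
  shows "smooth_fun n U g"
  unfolding smooth_fun_def
proof (intro allI impI conjI ballI)
  fix "is" assume "is": "set is \<subseteq> {..<n}"
  note sub = domain_subset[OF assms(1)]
  have "continuous_on U (foldr partial is g)"
    unfolding continuous_on_domain_iff[OF assms(1)]
  proof
    fix x assume "x \<in> U"
    from assms(2)[OF this] obtain W where W: "domain n W" "x \<in> W" "smooth_fun n W g" by blast
    then show "continuous (at x within Rn n) (foldr partial is g)"
      using "is" continuous_on_domain_iff[OF W(1), of "foldr partial is g"] domain_subset[OF W(1)]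
      by (auto simp: smooth_fun_def continuous_map_domain_iff)
  qed
  then show "continuous_map (subtopology (Euclidean_space n) U) euclideanreal (foldr partial is g)"
    using sub by (simp add: continuous_map_domain_iff)
  fix i x assume "i < n" "x \<in> U"
  then show "(\<lambda>t. foldr partial is g (x(i := t))) differentiable (at (x i))"
    using assms(2)[of x] "is" unfolding smooth_fun_def by blast
qed

lemma smooth_fun_subset:
  assumes "smooth_fun n U g" "V \<subseteq> U"
  shows "smooth_fun n V g"
  using assms unfolding smooth_fun_def
  by (meson continuous_map_from_subtopology_mono subsetD)

text \<open>
  Coinduction up to the algebra generated by a set \<open>G\<close>: the partial derivatives of the functions
  in \<open>G\<close> only have to be polynomials in functions from \<open>G\<close>. This covers the product, quotient and
  chain rules, whose right-hand sides are of this form.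
\<close>

inductive_set alg :: "('a \<Rightarrow> real) set \<Rightarrow> ('a \<Rightarrow> real) set" for G where
  gen: "g \<in> G \<Longrightarrow> g \<in> alg G"
| const: "(\<lambda>_. c) \<in> alg G"
| add: "g \<in> alg G \<Longrightarrow> h \<in> alg G \<Longrightarrow> (\<lambda>x. g x + h x) \<in> alg G"
| mult: "g \<in> alg G \<Longrightarrow> h \<in> alg G \<Longrightarrow> (\<lambda>x. g x * h x) \<in> alg G"

lemma alg_sum:
  assumes "\<And>j. j \<in> J \<Longrightarrow> g j \<in> alg G"
  shows "(\<lambda>x. \<Sum>j\<in>J. g j x) \<in> alg G"
  using assms by (induction J rule: infinite_finite_induct) (auto intro: alg.intros)

lemma smooth_fun_coinduct_alg:
  assumes "domain n U" "g \<in> alg G"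
    and cont: "\<And>g. g \<in> G \<Longrightarrow> continuous_on U g"
    and step: "\<And>g i. g \<in> G \<Longrightarrow> i < n \<Longrightarrow> \<exists>h\<in>alg G. \<forall>x\<in>U. g has_partial i (h x) at x"
  shows "smooth_fun n U g"
proof (rule smooth_fun_coinduct[OF assms(1,2)])
  show "continuous_on U g" if "g \<in> alg G" for g
    using that by induction (auto intro: cont continuous_intros)
  show "\<exists>h\<in>alg G. \<forall>x\<in>U. g has_partial i (h x) at x" if "g \<in> alg G" "i < n" for g i
    using that
  proof induction
    case (gen g) then show ?case using step by blast
  next
    case (const c) show ?case by (rule bexI[of _ "\<lambda>_. 0"]) (auto intro: alg.intros)
  next
    case (add g h)
    then obtain g' h' where *: "g' \<in> alg G" "h' \<in> alg G" "\<forall>x\<in>U. g has_partial i (g' x) at x"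
      "\<forall>x\<in>U. h has_partial i (h' x) at x" by blast
    then show ?case
      by (intro bexI[of _ "\<lambda>x. g' x + h' x"] ballI DERIV_add alg.add) blast+
  next
    case (mult g h)
    then obtain g' h' where *: "g' \<in> alg G" "h' \<in> alg G" "\<forall>x\<in>U. g has_partial i (g' x) at x"
      "\<forall>x\<in>U. h has_partial i (h' x) at x" by blast
    have "(\<lambda>x. g' x * h x + h' x * g x) \<in> alg G"
      by (intro alg.add alg.mult * mult)
    then show ?case
    proof (intro bexI[of _ "\<lambda>x. g' x * h x + h' x * g x"] ballI)
      show "(\<lambda>x. g x * h x) has_partial i (g' x * h x + h' x * g x) at x" if "x \<in> U" for x
        using DERIV_mult[OF bspec[OF *(3) that] bspec[OF *(4) that]] by simp
    qed
  qed
qed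

text \<open>Take all smooth functions as generators: the partial derivative of a generator is again
  a generator.\<close>

lemma smooth_fun_alg:
  assumes "domain n U" "\<And>g. g \<in> G \<Longrightarrow> smooth_fun n U g" "h \<in> alg G"
  shows "smooth_fun n U h"
proof (rule smooth_fun_coinduct_alg[OF assms(1), where G = "{g. smooth_fun n U g}"])
  note sub = domain_subset[OF assms(1)]
  show "h \<in> alg {g. smooth_fun n U g}"
    using assms(3) by induction (auto intro: alg.intros assms(2))
  show "continuous_on U g" if "g \<in> {g. smooth_fun n U g}" for g
    using that smooth_fun_continuous[OF _ sub] by simp
  show "\<exists>h\<in>alg {g. smooth_fun n U g}. \<forall>x\<in>U. g has_partial i (h x) at x"
    if "g \<in> {g. smooth_fun n U g}" "i < n" for g i
    using that smooth_fun_has_partial[OF _ sub, of g i] smooth_fun_partial[OF _ sub, of g i]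
    by (intro bexI[of _ "partial i g"] alg.gen) auto
qed

lemma smooth_fun_const: "domain n U \<Longrightarrow> smooth_fun n U (\<lambda>_. c)"
  by (rule smooth_fun_alg[of _ _ "{}"]) (auto intro: alg.intros)

lemma smooth_fun_diff:
  assumes "domain n U" "smooth_fun n U g" "smooth_fun n U h"
  shows "smooth_fun n U (\<lambda>x. g x - h x)"
proof -
  \<comment> \<open>The factor is written as a constant function so that the term has the form
    produced by the rules of \<open>alg\<close>.\<close>
  have "(\<lambda>x. g x + (\<lambda>_. -1) x * h x) \<in> alg {g, h}"
    by (intro alg.intros) auto
  then have "smooth_fun n U (\<lambda>x. g x + (-1) * h x)"
    by (rule smooth_fun_alg[rotated 2]) (use assms in auto)
  then show ?thesis by simp
qed

lemma smooth_fun_add: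
  assumes "domain n U" "smooth_fun n U g" "smooth_fun n U h"
  shows "smooth_fun n U (\<lambda>x. g x + h x)"
  by (rule smooth_fun_alg[OF assms(1), of "{g, h}"]) (use assms in \<open>auto intro: alg.intros\<close>)

lemma smooth_fun_mult:
  assumes "domain n U" "smooth_fun n U g" "smooth_fun n U h"
  shows "smooth_fun n U (\<lambda>x. g x * h x)"
  by (rule smooth_fun_alg[OF assms(1), of "{g, h}"]) (use assms in \<open>auto intro: alg.intros\<close>)

lemma smooth_fun_coord:
  assumes "domain n U"
  shows "smooth_fun n U (\<lambda>x. x j)"
proof (rule smooth_fun_coinduct_alg[OF assms, where G = "{\<lambda>x. x j}"])
  show "\<exists>h\<in>alg {\<lambda>x. x j}. \<forall>x\<in>U. g has_partial i (h x) at x" if "g \<in> {\<lambda>x. x j}" "i < n" for g i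
    using that by (intro bexI[of _ "\<lambda>_. if i = j then 1 else 0"] ballI alg.const)
      (auto simp: fun_upd_def)
  show "continuous_on U g" if "g \<in> {\<lambda>x. x j}" for g
    using that continuous_on_product_coordinates[of j] continuous_on_subset by blast
qed (auto intro: alg.intros)

text \<open>The derivative of \<open>1/g\<close> is minus the product of \<open>1/g\<close>, a
  partial derivative of \<open>g\<close>, and \<open>1/g\<close>: a polynomial in \<open>1/g\<close>
  and smooth functions. Hence these are the generators.\<close>

lemma smooth_fun_inverse:
  assumes "domain n U" "smooth_fun n U g" "\<And>x. x \<in> U \<Longrightarrow> g x \<noteq> 0"
  shows "smooth_fun n U (\<lambda>x. inverse (g x))"
proof (rule smooth_fun_coinduct_alg[OF assms(1), where G = "insert (\<lambda>x. inverse (g x)) {g. smooth_fun n U g}"])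
  let ?G = "insert (\<lambda>x. inverse (g x)) {g. smooth_fun n U g}"
  note sub = domain_subset[OF assms(1)]
  show "continuous_on U h" if "h \<in> ?G" for h
    using that smooth_fun_continuous[OF _ sub] assms by (auto intro: continuous_intros)
  show "\<exists>k\<in>alg ?G. \<forall>x\<in>U. h has_partial i (k x) at x" if "h \<in> ?G" "i < n" for h i
    using that(1)
  proof
    assume h: "h = (\<lambda>x. inverse (g x))"
    show ?thesis
    proof (intro bexI[of _ "\<lambda>x. (\<lambda>_. -1) x * (inverse (g x) * partial i g x * inverse (g x))"] ballI)
      fix x assume x: "x \<in> U"
      show "h has_partial i ((-1) * (inverse (g x) * partial i g x * inverse (g x))) at x"
        unfolding h
        using DERIV_inverse'[OF smooth_fun_has_partial[OF assms(2) sub that(2) x]] assms(3)[OF x] by simp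
    next
      show "(\<lambda>x. (\<lambda>_. -1) x * (inverse (g x) * partial i g x * inverse (g x))) \<in> alg ?G"
        using smooth_fun_partial[OF assms(2) sub that(2)] by (intro alg.mult alg.const alg.gen) auto
    qed
  next
    assume "h \<in> {g. smooth_fun n U g}"
    then show ?thesis
      using smooth_fun_has_partial[OF _ sub, of h i] smooth_fun_partial[OF _ sub, of h i] that
      by (intro bexI[of _ "partial i h"] alg.gen) auto
  qed
qed (auto intro: alg.intros)


section \<open>Mean value theorem and chain rule\<close>

text \<open>The endpoints are unordered, so that difference quotients on both sides of a point are
  treated at once.\<close>

lemma partial_mvt:
  assumes "smooth_fun n U g" "U \<subseteq> Rn n" "j < n" "\<And>s. s \<in> closed_segment a b \<Longrightarrow> x(j := s) \<in> U"
  shows "\<exists>s\<in>closed_segment a b. g (x(j := b)) - g (x(j := a)) = (b - a) * partial j g (x(j := s))"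
proof -
  have d: "((\<lambda>t. g (x(j := t))) has_real_derivative partial j g (x(j := s))) (at s)"
    if "s \<in> closed_segment a b" for s
    using smooth_fun_has_partial[OF assms(1-3) assms(4)[OF that]] by simp
  consider "a = b" | "a < b" | "b < a" by linarith
  then show ?thesis
  proof cases
    case 2
    from MVT2[OF this, of "\<lambda>t. g (x(j := t))" "\<lambda>s. partial j g (x(j := s))"] d 2
    show ?thesis by (force simp: closed_segment_eq_real_ivl)
  next
    case 3
    from MVT2[OF this, of "\<lambda>t. g (x(j := t))" "\<lambda>s. partial j g (x(j := s))"] d 3
    obtain z where z: "z > b" "z < a" "g (x(j := a)) - g (x(j := b)) = (a - b) * partial j g (x(j := z))"
      by (force simp: closed_segment_eq_real_ivl)
    then show ?thesis
      by (intro bexI[of _ z]) (auto simp: closed_segment_eq_real_ivl algebra_simps)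
  qed auto
qed

lemma continuous_on_box:
  assumes "domain n U" "continuous_on U g" "x \<in> U" "e > 0"
  obtains \<delta> where "\<delta> > 0" "\<And>y. y \<in> box_at n x \<delta> \<Longrightarrow> y \<in> U \<and> \<bar>g y - (g x :: real)\<bar> < e"
proof -
  have "domain n {y \<in> U. g y \<in> ball (g x) e}"
    by (intro domain_preimage_open assms) auto
  from domain_contains_box[OF this, of x] assms obtain \<delta>
    where "\<delta> > 0" "box_at n x \<delta> \<subseteq> {y \<in> U. g y \<in> ball (g x) e}" by auto
  then show thesis using that[of \<delta>] by (auto simp: dist_real_def abs_minus_commute)
qed

text \<open>Passing from \<open>\<gamma> t0\<close> to \<open>\<gamma> t\<close> one coordinate at a
  time splits the increment of \<open>g\<close> into increments along coordinate lines. The mean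
  value theorem expresses each by a partial derivative at an intermediate point, and continuity of
  the partial derivatives gives the limit.\<close>

lemma chain_rule_curve:
  assumes U: "domain n U" and g: "smooth_fun n U g" and x: "\<gamma> t0 \<in> U"
    and \<gamma>: "\<And>j. j < n \<Longrightarrow> ((\<lambda>t. \<gamma> t j) has_real_derivative \<gamma>' j) (at t0)"
    and E: "eventually (\<lambda>t. \<gamma> t \<in> Rn n) (nhds t0)"
  shows "((\<lambda>t. g (\<gamma> t)) has_real_derivative (\<Sum>j<n. partial j g (\<gamma> t0) * \<gamma>' j)) (at t0)"
proof -
  note sub = domain_subset[OF U]
  \<comment> \<open>The first \<open>j\<close> coordinates have already moved, the others are still
    at \<open>t0\<close>.\<close>
  define z where "z j t = (\<lambda>i. if i < j then \<gamma> t i else \<gamma> t0 i)" for j t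
  have near: "eventually (\<lambda>t. \<forall>i\<in>{..<n}. \<bar>\<gamma> t i - \<gamma> t0 i\<bar> < \<delta>) (nhds t0)" if "\<delta> > 0" for \<delta>
  proof (rule eventually_ball_finite, simp, rule ballI)
    fix i assume "i \<in> {..<n}"
    then have "isCont (\<lambda>t. \<gamma> t i) t0" using \<gamma> DERIV_isCont by blast
    then have "((\<lambda>t. \<gamma> t i) \<longlongrightarrow> \<gamma> t0 i) (nhds t0)"
      unfolding isCont_def using tendsto_at_iff_tendsto_nhds[of "\<lambda>t. \<gamma> t i" t0] by simp
    from tendstoD[OF this that] show "eventually (\<lambda>t. \<bar>\<gamma> t i - \<gamma> t0 i\<bar> < \<delta>) (nhds t0)"
      by (simp add: dist_real_def)
  qed
  have zbox: "(z j t)(j := s) \<in> box_at n (\<gamma> t0) \<delta>"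
    if "\<forall>i\<in>{..<n}. \<bar>\<gamma> t i - \<gamma> t0 i\<bar> < \<delta>" "j < n" "s \<in> closed_segment (\<gamma> t0 j) (\<gamma> t j)" for \<delta> t j s
  proof -
    have "\<bar>s - \<gamma> t0 j\<bar> \<le> \<bar>\<gamma> t j - \<gamma> t0 j\<bar>"
      using that(3) by (auto simp: closed_segment_eq_real_ivl split: if_splits)
    moreover have "0 < \<delta>" using that(1,2) by fastforce
    moreover have "\<bar>\<gamma> t j - \<gamma> t0 j\<bar> < \<delta>" using that(1,2) by simp
    ultimately have "\<bar>s - \<gamma> t0 j\<bar> < \<delta>" by linarith
    moreover have "\<gamma> t0 i = 0" if "i \<ge> n" for i using that x sub by (auto simp: mem_Rn)
    ultimately show ?thesis
      using that(1,2) by (auto simp: box_at_def z_def mem_Rn)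
  qed
  have "((\<lambda>t. g (z j t)) has_real_derivative (\<Sum>i<j. partial i g (\<gamma> t0) * \<gamma>' i)) (at t0)" if "j \<le> n" for j
    using that
  proof (induction j)
    case 0
    then show ?case by (simp add: z_def)
  next
    case (Suc j)
    then have j: "j < n" by simp
    have zS: "z (Suc j) t = (z j t)(j := \<gamma> t j)" "z j t = (z j t)(j := \<gamma> t0 j)" for t
      by (auto simp: z_def)
    obtain \<delta> where \<delta>: "\<delta> > 0" "box_at n (\<gamma> t0) \<delta> \<subseteq> U" using domain_contains_box[OF U x] by metis
    define P where "P t s \<longleftrightarrow> s \<in> closed_segment (\<gamma> t0 j) (\<gamma> t j) \<and>
      g (z (Suc j) t) - g (z j t) = (\<gamma> t j - \<gamma> t0 j) * partial j g ((z j t)(j := s))" for t s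
    \<comment> \<open>A mean value point for each \<open>t\<close>. Its only property used for the
      limit is that it stays between \<open>\<gamma> t0 j\<close> and \<open>\<gamma> t j\<close>,
      hence in ever smaller cubes.\<close>
    define \<xi> where "\<xi> t = (SOME s. P t s)" for t
    have \<xi>: "eventually (\<lambda>t. P t (\<xi> t)) (nhds t0)"
      using near[OF \<delta>(1)]
    proof eventually_elim
      case (elim t)
      have "\<exists>s\<in>closed_segment (\<gamma> t0 j) (\<gamma> t j). g ((z j t)(j := \<gamma> t j)) - g ((z j t)(j := \<gamma> t0 j)) =
        (\<gamma> t j - \<gamma> t0 j) * partial j g ((z j t)(j := s))"
        using zbox[OF elim j] \<delta>(2) by (intro partial_mvt[OF g sub j]) auto
      then have "\<exists>s. P t s" unfolding P_def using zS by metis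
      then show ?case unfolding \<xi>_def by (rule someI_ex)
    qed
    have lim: "((\<lambda>t. partial j g ((z j t)(j := \<xi> t))) \<longlongrightarrow> partial j g (\<gamma> t0)) (at t0)"
    proof (rule tendstoI)
      fix e :: real assume "e > 0"
      from continuous_on_box[OF U smooth_fun_continuous[OF smooth_fun_partial[OF g sub j] sub] x this]
      obtain d where d: "d > 0" "\<And>y. y \<in> box_at n (\<gamma> t0) d \<Longrightarrow> \<bar>partial j g y - partial j g (\<gamma> t0)\<bar> < e"
        by metis
      have "eventually (\<lambda>t. \<bar>partial j g ((z j t)(j := \<xi> t)) - partial j g (\<gamma> t0)\<bar> < e) (nhds t0)"
        using near[OF d(1)] \<xi> by eventually_elim (rule d(2), rule zbox, auto simp: P_def j)
      then show "eventually (\<lambda>t. dist (partial j g ((z j t)(j := \<xi> t))) (partial j g (\<gamma> t0)) < e) (at t0)"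
        unfolding dist_real_def by (rule eventually_nhds_conv_at[THEN iffD1, THEN conjunct1])
    qed
    have "((\<lambda>t. g (z (Suc j) t) - g (z j t)) has_real_derivative partial j g (\<gamma> t0) * \<gamma>' j) (at t0)"
      unfolding has_field_derivative_iff
    proof (rule Lim_transform_eventually)
      show "((\<lambda>t. partial j g ((z j t)(j := \<xi> t)) * ((\<gamma> t j - \<gamma> t0 j) / (t - t0))) \<longlongrightarrow>
        partial j g (\<gamma> t0) * \<gamma>' j) (at t0)"
        using \<gamma>[OF j] lim unfolding has_field_derivative_iff by (intro tendsto_mult)
      have z0: "z j t0 = \<gamma> t0" for j by (auto simp: z_def)
      have "eventually (\<lambda>t. P t (\<xi> t)) (at t0)"
        using \<xi> by (simp add: eventually_nhds_conv_at)
      then show "eventually (\<lambda>t. partial j g ((z j t)(j := \<xi> t)) * ((\<gamma> t j - \<gamma> t0 j) / (t - t0)) =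
        (g (z (Suc j) t) - g (z j t) - (g (z (Suc j) t0) - g (z j t0))) / (t - t0)) (at t0)"
        by eventually_elim (simp add: P_def z0)
    qed
    from DERIV_add[OF Suc.IH this] j show ?case by simp
  qed
  from this[of n] have "((\<lambda>t. g (z n t)) has_real_derivative (\<Sum>j<n. partial j g (\<gamma> t0) * \<gamma>' j)) (at t0)"
    by simp
  moreover have ev: "eventually (\<lambda>t. g (z n t) = g (\<gamma> t)) (nhds t0)"
    using E
  proof eventually_elim
    case (elim t)
    \<comment> \<open>From index \<open>n\<close> on both points vanish: \<open>\<gamma> t\<close>
      by \<open>E\<close>, and \<open>\<gamma> t0\<close> as a point of \<open>U\<close>.\<close>
    have "z n t = \<gamma> t"
      using elim x sub by (force simp: z_def mem_Rn)
    then show ?case by simp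
  qed
  ultimately show ?thesis
    using DERIV_cong_ev[OF refl ev refl] by simp
qed


section \<open>Smooth maps\<close>

lemma smooth_mapD:
  assumes "smooth_map m V n F"
  shows "F \<in> V \<rightarrow> Rn n" "j < n \<Longrightarrow> smooth_fun m V (\<lambda>x. F x j)"
  using assms by (auto simp: smooth_map_def)

lemma smooth_map_continuous:
  assumes "smooth_map m V n F" "V \<subseteq> Rn m"
  shows "continuous_on V F"
  using assms smooth_fun_continuous by (intro continuous_on_into_Rn[of F V n]) (auto simp: smooth_map_def)

lemma has_partial_compose:
  assumes F: "smooth_map m V n F" and V: "domain m V" and FU: "F \<in> V \<rightarrow> U"
    and U: "domain n U" and g: "smooth_fun n U g" and x: "x \<in> V" and i: "i < m"
  shows "(\<lambda>x. g (F x)) has_partial i (\<Sum>j<n. partial j g (F x) * partial i (\<lambda>y. F y j) x) at x"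
proof -
  have "eventually (\<lambda>t. F (x(i := t)) \<in> Rn n) (nhds (x i))"
    using eventually_fun_upd_mem[OF V x i] by eventually_elim (use FU domain_subset[OF U] in auto)
  moreover have "F (x(i := x i)) \<in> U" using FU x by auto
  moreover have "((\<lambda>t. F (x(i := t)) j) has_real_derivative partial i (\<lambda>y. F y j) x) (at (x i))" if "j < n" for j
    using smooth_fun_has_partial[OF smooth_mapD(2)[OF F that] domain_subset[OF V] i x] .
  ultimately show ?thesis
    using chain_rule_curve[OF U g, of "\<lambda>t. F (x(i := t))" "x i"] by simp
qed

text \<open>The generators are the smooth functions on \<open>V\<close> and all composites of smooth
  functions on \<open>U\<close> with \<open>F\<close>. The chain rule writes a derivative of such a
  composite as a sum of products of generators.\<close>

lemma smooth_fun_compose: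
  assumes F: "smooth_map m V n F" and V: "domain m V" and FU: "F \<in> V \<rightarrow> U"
    and U: "domain n U" and g: "smooth_fun n U g"
  shows "smooth_fun m V (\<lambda>x. g (F x))"
proof -
  define G where "G = {a. smooth_fun m V a} \<union> {\<lambda>x. b (F x) |b. smooth_fun n U b}"
  note sub = domain_subset[OF U] domain_subset[OF V]
  show ?thesis
  proof (rule smooth_fun_coinduct_alg[OF V, where G = G])
    show "(\<lambda>x. g (F x)) \<in> alg G" using g by (intro alg.gen) (auto simp: G_def)
    fix a assume a: "a \<in> G"
    then show "continuous_on V a"
      using smooth_fun_continuous sub smooth_map_continuous[OF F sub(2)] FU
      by (auto simp: G_def intro!: continuous_on_compose2[where f = F])
    fix i assume i: "i < m"
    show "\<exists>h\<in>alg G. \<forall>x\<in>V. a has_partial i (h x) at x"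
    proof (cases "smooth_fun m V a")
      case False
      then obtain b where b: "smooth_fun n U b" "a = (\<lambda>x. b (F x))" using a unfolding G_def by blast
      have *: "(\<lambda>x. \<Sum>j<n. partial j b (F x) * partial i (\<lambda>y. F y j) x) \<in> alg G"
      proof (intro alg_sum alg.mult alg.gen)
        fix j assume "j \<in> {..<n}"
        then show "(\<lambda>x. partial j b (F x)) \<in> G" "partial i (\<lambda>y. F y j) \<in> G"
          using smooth_fun_partial[OF b(1) sub(1), of j] smooth_fun_partial[OF smooth_mapD(2)[OF F] sub(2) i]
          by (auto simp: G_def)
      qed
      have "\<forall>x\<in>V. a has_partial i (\<Sum>j<n. partial j b (F x) * partial i (\<lambda>y. F y j) x) at x"
        unfolding b(2) by (intro ballI has_partial_compose[OF F V FU U b(1) _ i])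
      then show ?thesis by (rule bexI[OF _ *])
    next
      case True
      then show ?thesis
        using smooth_fun_has_partial[OF _ sub(2), of a i] smooth_fun_partial[OF _ sub(2), of a i] i
        by (intro bexI[of _ "partial i a"] alg.gen) (auto simp: G_def)
    qed
  qed
qed

lemma smooth_map_compose:
  assumes "smooth_map m V n F" "domain m V" "F \<in> V \<rightarrow> U" "domain n U" "smooth_map n U k G"
  shows "smooth_map m V k (\<lambda>x. G (F x))"
  unfolding smooth_map_def
proof (intro conjI allI impI)
  show "(\<lambda>x. G (F x)) \<in> V \<rightarrow> Rn k"
    using assms(3) smooth_mapD(1)[OF assms(5)] by auto
  show "smooth_fun m V (\<lambda>x. G (F x) j)" if "j < k" for j
    using smooth_fun_compose[OF assms(1-4), of "\<lambda>y. G y j"] smooth_mapD(2)[OF assms(5) that] by simp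
qed

lemma smooth_map_cong:
  assumes "domain m V" "\<And>x. x \<in> V \<Longrightarrow> F x = G x" "smooth_map m V n F"
  shows "smooth_map m V n G"
  unfolding smooth_map_def
proof (intro conjI allI impI)
  show "G \<in> V \<rightarrow> Rn n" using assms(2) smooth_mapD(1)[OF assms(3)] by (metis Pi_I Pi_mem)
  show "smooth_fun m V (\<lambda>x. G x j)" if "j < n" for j
    using smooth_fun_cong[OF assms(1) _ smooth_mapD(2)[OF assms(3) that]] assms(2) by simp
qed

lemma smooth_map_subset: "smooth_map m V n F \<Longrightarrow> W \<subseteq> V \<Longrightarrow> smooth_map m W n F"
  unfolding smooth_map_def using smooth_fun_subset by blast

lemma smooth_map_local:
  assumes "domain m V" "\<And>x. x \<in> V \<Longrightarrow> \<exists>W. domain m W \<and> x \<in> W \<and> smooth_map m W n F"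
  shows "smooth_map m V n F"
  unfolding smooth_map_def
proof (intro conjI allI impI)
  show "F \<in> V \<rightarrow> Rn n" using assms(2) by (fastforce simp: smooth_map_def)
  show "smooth_fun m V (\<lambda>x. F x j)" if "j < n" for j
    using assms(2) smooth_mapD(2)[OF _ that] by (intro smooth_fun_local[OF assms(1)]) metis
qed

lemma smooth_map_id: "domain m V \<Longrightarrow> smooth_map m V m (\<lambda>x. x)"
  unfolding smooth_map_def using smooth_fun_coord domain_subset by blast

section \<open>Jacobian matrices\<close>

lemma jacobian_mem_Rn: "jacobian m n F x v \<in> Rn n"
  by (simp add: jacobian_def mem_Rn)

lemma jacobian_cong:
  assumes "domain m V" "x \<in> V" "\<And>y. y \<in> V \<Longrightarrow> F y = G y"
  shows "jacobian m n F x v = jacobian m n G x v"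
proof -
  have "partial i (\<lambda>y. F y j) x = partial i (\<lambda>y. G y j) x" if "i < m" for i j
    using assms(3) by (intro partial_cong[OF assms(1,2) that]) simp
  then show ?thesis by (auto simp: jacobian_def)
qed

lemma jacobian_compose:
  assumes "smooth_map m V n F" "domain m V" "F \<in> V \<rightarrow> U" "domain n U" "smooth_map n U k G" "x \<in> V"
  shows "jacobian m k (\<lambda>x. G (F x)) x v = jacobian n k G (F x) (jacobian m n F x v)"
proof
  fix j
  show "jacobian m k (\<lambda>x. G (F x)) x v j = jacobian n k G (F x) (jacobian m n F x v) j"
  proof (cases "j < k")
    case True
    have "partial i (\<lambda>y. G (F y) j) x = (\<Sum>l<n. partial l (\<lambda>y. G y j) (F x) * partial i (\<lambda>y. F y l) x)"
      if "i < m" for i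
      by (intro partial_eqI has_partial_compose[OF assms(1-4) smooth_mapD(2)[OF assms(5) True] assms(6) that])
    then have "(\<Sum>i<m. partial i (\<lambda>y. G (F y) j) x * v i) =
      (\<Sum>i<m. \<Sum>l<n. partial l (\<lambda>y. G y j) (F x) * (partial i (\<lambda>y. F y l) x * v i))"
      by (intro sum.cong) (auto simp: sum_distrib_right mult.assoc)
    also have "\<dots> = (\<Sum>l<n. partial l (\<lambda>y. G y j) (F x) * (\<Sum>i<m. partial i (\<lambda>y. F y l) x * v i))"
      by (subst sum.swap) (simp add: sum_distrib_left)
    finally show ?thesis using True by (simp add: jacobian_def)
  qed (simp add: jacobian_def)
qed

lemma partial_coord: "partial i (\<lambda>y. y j) x = (if i = j then 1 else 0)"
  by (intro partial_eqI) (auto simp: fun_upd_def)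

lemma jacobian_id:
  assumes "v \<in> Rn m"
  shows "jacobian m m (\<lambda>x. x) x v = v"
proof
  show "jacobian m m (\<lambda>x. x) x v j = v j" for j
  proof (cases "j < m")
    case True
    have "(\<Sum>i<m. (if i = j then 1 else 0) * v i) = (\<Sum>i<m. if i = j then v i else 0)"
      by (intro sum.cong) auto
    then show ?thesis using True by (simp add: jacobian_def partial_coord)
  qed (use assms in \<open>simp add: jacobian_def mem_Rn\<close>)
qed

lemma jacobian_diff:
  "jacobian m n F x (\<lambda>i. v i - w i) = (\<lambda>j. jacobian m n F x v j - jacobian m n F x w j)"
  by (auto simp: jacobian_def right_diff_distrib sum_subtractf)

lemma jacobian_zero: "jacobian m n F x (\<lambda>_. 0) = (\<lambda>_. 0)"
  by (auto simp: jacobian_def)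


section \<open>Local left inverses of immersions\<close>

lemma smooth_map_fun_upd:
  assumes "domain n U" "smooth_fun n U g" "k < n"
  shows "smooth_map n U n (\<lambda>x. x(k := g x))"
  unfolding smooth_map_def
proof (intro conjI allI impI)
  show "(\<lambda>x. x(k := g x)) \<in> U \<rightarrow> Rn n"
    using fun_upd_mem_Rn[OF _ assms(3)] domain_subset[OF assms(1)] by blast
  show "smooth_fun n U (\<lambda>x. (x(k := g x)) j)" for j
    using assms(2) smooth_fun_coord[OF assms(1)] by (cases "j = k") auto
qed

text \<open>An inverse function theorem for maps that alter one coordinate. Such a map preserves the
  lines parallel to axis \<open>k\<close>, and on each of them it is injective by the mean value
  theorem. Invariance of domain makes the image open and the inverse continuous, and only one
  coordinate of the inverse remains to be differentiated.\<close>

lemma coordinate_change: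
  assumes U: "domain n U" and g: "smooth_fun n U g" and k: "k < n" and x0: "x0 \<in> U"
    and nz: "partial k g x0 \<noteq> 0"
  obtains B W K where "domain n B" "x0 \<in> B" "B \<subseteq> U" "domain n W" "smooth_map n W n K" "K \<in> W \<rightarrow> B"
    "\<And>x. x \<in> B \<Longrightarrow> x(k := g x) \<in> W" "\<And>x. x \<in> B \<Longrightarrow> K (x(k := g x)) = x"
    "\<And>y. y \<in> W \<Longrightarrow> (K y)(k := g (K y)) = y"
proof -
  note sub = domain_subset[OF U]
  note gk = smooth_fun_partial[OF g sub k]
  \<comment> \<open>With this tolerance the derivative cannot reach 0 inside the cube.\<close>
  from continuous_on_box[OF U smooth_fun_continuous[OF gk sub] x0, of "\<bar>partial k g x0\<bar>"] nz
  obtain \<delta> where \<delta>: "\<delta> > 0"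
    "\<And>y. y \<in> box_at n x0 \<delta> \<Longrightarrow> y \<in> U \<and> \<bar>partial k g y - partial k g x0\<bar> < \<bar>partial k g x0\<bar>"
    by auto
  define B where "B = box_at n x0 \<delta>"
  have B: "domain n B" "B \<subseteq> U" "\<And>y. y \<in> B \<Longrightarrow> partial k g y \<noteq> 0"
    using \<delta>(2) domain_box_at by (force simp: B_def)+
  have x0B: "x0 \<in> B" using x0 sub \<delta>(1) by (auto simp: B_def box_at_def)
  have BE: "B \<subseteq> Rn n" by (rule domain_subset[OF B(1)])
  have gB: "smooth_fun n B g" by (rule smooth_fun_subset[OF g B(2)])
  define G where "G x = x(k := g x)" for x
  have Gs: "smooth_map n B n G"
    unfolding G_def by (rule smooth_map_fun_upd[OF B(1) gB k])
  have Gc: "continuous_on B G" by (rule smooth_map_continuous[OF Gs BE])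
  have inj: "inj_on G B"
  proof (rule inj_onI)
    fix x y assume xy: "x \<in> B" "y \<in> B" "G x = G y"
    have off: "x i = y i" if "i \<noteq> k" for i
      using fun_cong[OF xy(3), of i] that by (simp add: G_def)
    then have y: "y = x(k := y k)" by auto
    have gxy: "g x = g y" using fun_cong[OF xy(3), of k] by (simp add: G_def)
    \<comment> \<open>\<open>x\<close> and \<open>y\<close> differ at most in coordinate
      \<open>k\<close>, and the cube contains the segment between them. As \<open>g\<close> agrees
      at the ends and its derivative has no zero in between, the segment is a point.\<close>
    have "x(k := s) \<in> B" if "s \<in> closed_segment (x k) (y k)" for s
    proof -
      have "\<bar>x k - x0 k\<bar> < \<delta>" "\<bar>y k - x0 k\<bar> < \<delta>" using xy k by (auto simp: B_def box_at_def)
      then have "\<bar>s - x0 k\<bar> < \<delta>" using that by (auto simp: closed_segment_eq_real_ivl split: if_splits)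
      then show ?thesis using xy(1) fun_upd_mem_Rn[OF _ k] by (auto simp: B_def box_at_def)
    qed
    from partial_mvt[OF gB BE k this] obtain s where "s \<in> closed_segment (x k) (y k)" "x(k := s) \<in> B"
      "g (x(k := y k)) - g (x(k := x k)) = (y k - x k) * partial k g (x(k := s))"
      by (metis \<open>\<And>s. s \<in> closed_segment (x k) (y k) \<Longrightarrow> x(k := s) \<in> B\<close>)
    moreover have "g (x(k := y k)) = g (x(k := x k))"
      using gxy y by simp
    ultimately have "y k = x k" using B(3) by auto
    then show "x = y" using y by simp
  qed
  define W where "W = G ` B"
  \<comment> \<open>For \<open>C = B\<close> this shows that \<open>W\<close> is open; for smaller
    \<open>C\<close> it yields the continuity of \<open>K\<close>.\<close>
  have open_image: "domain n (G ` C)" if "domain n C" "C \<subseteq> B" for C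
    unfolding domain_def
  proof (rule invariance_of_domain_Euclidean_space)
    show "openin (Euclidean_space n) C" using that(1) by (simp add: domain_def)
    show "inj_on G C" using inj that(2) inj_on_subset by blast
    show "continuous_map (subtopology (Euclidean_space n) C) (Euclidean_space n) G"
      using that Gc smooth_mapD(1)[OF Gs] BE
      by (subst continuous_map_domain_Euclidean_iff) (auto intro: continuous_on_subset)
  qed
  have W: "domain n W" unfolding W_def by (rule open_image[OF B(1) order_refl])
  note WE = domain_subset[OF W]
  define K where "K = inv_into B G"
  have KB: "K y \<in> B" if "y \<in> W" for y
    using that by (auto simp: K_def W_def inv_into_into)
  have GK: "G (K y) = y" if "y \<in> W" for y
    using that by (auto simp: K_def W_def f_inv_into_f)
  have KG: "K (G x) = x" if "x \<in> B" for x
    using that inj by (simp add: K_def)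
  have Koff: "K y j = y j" if "y \<in> W" "j \<noteq> k" for y j
    using fun_cong[OF GK[OF that(1)], of j] that(2) by (simp add: G_def)
  have gK: "g (K y) = y k" if "y \<in> W" for y
    using fun_cong[OF GK[OF that(1)], of k] by (simp add: G_def)
  have Kc: "continuous_on W K"
  proof -
    have "continuous_map (subtopology (Euclidean_space n) W) (Euclidean_space n) K"
      unfolding continuous_map_def
    proof (intro conjI allI impI)
      show "K \<in> topspace (subtopology (Euclidean_space n) W) \<rightarrow> Rn n"
        using KB BE by auto
      fix T assume "openin (Euclidean_space n) T"
      then have "domain n (B \<inter> T)" using B(1) domain_Int by (simp add: domain_def)
      then have "domain n (G ` (B \<inter> T))" by (rule open_image) auto
      moreover have "{y \<in> topspace (subtopology (Euclidean_space n) W). K y \<in> T} = G ` (B \<inter> T)"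
        using WE KB GK KG by (force simp: W_def)
      moreover have "G ` (B \<inter> T) \<subseteq> W" by (auto simp: W_def)
      ultimately show "openin (subtopology (Euclidean_space n) W)
          {y \<in> topspace (subtopology (Euclidean_space n) W). K y \<in> T}"
        by (simp add: domain_def openin_subset_topspace_eq subset_openin_subtopology)
    qed
    then show ?thesis using WE by (simp add: continuous_map_domain_Euclidean_iff)
  qed
  \<comment> \<open>Only coordinates \<open>i\<close> and \<open>k\<close> of \<open>K y\<close>
    depend on \<open>y i\<close>. Writing \<open>u\<close> for the unknown derivative, the equation
    below becomes \<open>1 = partial k g * u\<close> if \<open>i = k\<close>, and
    \<open>0 = partial i g + partial k g * u\<close> otherwise; \<open>c i\<close> is the numerator
    of \<open>u\<close>.\<close>
  define c where "c i x = (if i = k then 1 else - partial i g x)" for i x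
  \<comment> \<open>Differentiating \<open>g (K y) = y k\<close> in direction \<open>i\<close> determines the partial derivatives of
    the only nontrivial coordinate of \<open>K\<close>.\<close>
  have partial_Kk: "(\<lambda>y. K y k) has_partial i (c i (K y) / partial k g (K y)) at y"
    if y: "y \<in> W" and i: "i < n" for y i
  proof -
    define x where "x = K y"
    have xB: "x \<in> B" using KB[OF y] by (simp add: x_def)
    have yi: "x i = y i" if "i \<noteq> k" using Koff[OF y that] by (simp add: x_def)
    define s where "s t = K (y(i := t)) k" for t
    \<comment> \<open>The way from \<open>x\<close> to \<open>K (y(i := t))\<close> has two legs:
      first coordinate \<open>i\<close> moves to \<open>t\<close>, then coordinate \<open>k\<close>
      to \<open>s t\<close>. For \<open>i = k\<close> the second update overwrites the first, and
      one leg remains.\<close>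
    define p where "p t \<xi> = (x(i := t))(k := \<xi>)" for t \<xi>
    have s0: "s (y i) = x k" by (simp add: s_def x_def)
    have evW: "eventually (\<lambda>t. y(i := t) \<in> W) (nhds (y i))"
      by (rule eventually_fun_upd_mem[OF W y i])
    have near: "eventually (\<lambda>t. \<bar>s t - x k\<bar> < e \<and> \<bar>t - y i\<bar> < e) (nhds (y i))" if "e > 0" for e
    proof -
      have "continuous_on W (\<lambda>y. K y k)"
        by (rule continuous_on_product_then_coordinatewise[OF Kc])
      then have "domain n {z \<in> W. K z k \<in> ball (x k) e}"
        by (rule domain_preimage_open[OF W]) auto
      from eventually_fun_upd_mem[OF this _ i, of y] y that
      have "eventually (\<lambda>t. y(i := t) \<in> {z \<in> W. K z k \<in> ball (x k) e}) (nhds (y i))"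
        by (simp add: x_def)
      moreover have "eventually (\<lambda>t. t \<in> ball (y i) e) (nhds (y i))"
        by (rule eventually_nhds_in_open) (use that in auto)
      ultimately show ?thesis
        by eventually_elim (auto simp: s_def dist_real_def abs_minus_commute)
    qed
    have pbox: "p t \<xi> \<in> box_at n x e"
      if "\<bar>s t - x k\<bar> < e \<and> \<bar>t - y i\<bar> < e" "\<xi> \<in> closed_segment (x k) (s t)" for t \<xi> e
    proof -
      have "\<bar>\<xi> - x k\<bar> < e" "0 < e"
        using that by (auto simp: closed_segment_eq_real_ivl split: if_splits)
      then show ?thesis
        using that(1) yi xB BE fun_upd_mem_Rn[OF fun_upd_mem_Rn[OF _ i] k, of x]
        by (auto simp: p_def box_at_def)
    qed
    have qbox: "x(i := \<eta>) \<in> box_at n x e"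
      if "\<bar>s t - x k\<bar> < e \<and> \<bar>t - y i\<bar> < e" "\<eta> \<in> closed_segment (x i) t" "i \<noteq> k" for t \<eta> e
    proof -
      have "\<bar>\<eta> - x i\<bar> < e" "0 < e"
        using that yi by (auto simp: closed_segment_eq_real_ivl split: if_splits)
      then show ?thesis
        using xB BE fun_upd_mem_Rn[OF _ i, of x] by (auto simp: box_at_def)
    qed
    obtain e where e: "e > 0" "box_at n x e \<subseteq> B" using domain_contains_box[OF B(1) xB] by metis
    \<comment> \<open>Whether \<open>s\<close> is differentiable is still open, so the equation
      cannot simply be differentiated. Instead the mean value theorem on both legs, with the pair
      \<open>z\<close> of intermediate points, expresses the difference quotient of \<open>s\<close>
      as a quotient with a known limit.\<close>
    define P where "P t z \<longleftrightarrow> fst z \<in> closed_segment (x k) (s t) \<and> snd z \<in> closed_segment (x i) t \<and>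
      (t - y i) * c i (x(i := snd z)) = (s t - x k) * partial k g (p t (fst z))" for t z
    define \<zeta> where "\<zeta> t = (SOME z. P t z)" for t
    have "eventually (\<lambda>t. P t (\<zeta> t)) (nhds (y i))"
      using near[OF e(1)] evW
    proof eventually_elim
      case (elim t)
      have pseg: "p t \<xi> \<in> B" if "\<xi> \<in> closed_segment (x k) (s t)" for \<xi>
        using pbox[OF elim(1) that] e(2) by auto
      have K': "K (y(i := t)) = p t (s t)"
      proof
        fix j show "K (y(i := t)) j = p t (s t) j"
          using Koff[OF elim(2), of j] Koff[OF y, of j] by (auto simp: p_def s_def x_def)
      qed
      have gK': "g (p t (s t)) = (y(i := t)) k" using gK[OF elim(2)] K' by simp
      have gx: "g x = y k" using gK[OF y] by (simp add: x_def)
      obtain \<xi> where \<xi>: "\<xi> \<in> closed_segment (x k) (s t)"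
        "g (p t (s t)) - g (p t (x k)) = (s t - x k) * partial k g (p t \<xi>)"
        using partial_mvt[OF gB BE k, of "x k" "s t" "x(i := t)"] pseg unfolding p_def by blast
      show ?case
      proof (cases "i = k")
        case True
        then have "p t (x k) = x" by (auto simp: p_def)
        \<comment> \<open>Here \<open>c i\<close> is constantly 1, and any point of the second
          segment will do.\<close>
        then have "P t (\<xi>, x i)" using \<xi> True gK' gx by (simp add: P_def c_def)
        then show ?thesis unfolding \<zeta>_def by (rule someI)
      next
        case False
        then have pk: "p t (x k) = x(i := t)" by (auto simp: p_def)
        have "x(i := \<eta>) \<in> B" if "\<eta> \<in> closed_segment (x i) t" for \<eta>
          using qbox[OF elim(1) that False] e(2) by auto
        from partial_mvt[OF gB BE i this] obtain \<eta> where \<eta>: "\<eta> \<in> closed_segment (x i) t"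
          "g (x(i := t)) - g (x(i := x i)) = (t - x i) * partial i g (x(i := \<eta>))" by blast
        have "(s t - x k) * partial k g (p t \<xi>) = y k - g (x(i := t))"
          using \<xi>(2) gK' False by (simp add: pk)
        moreover have "g (x(i := t)) - y k = (t - y i) * partial i g (x(i := \<eta>))"
          using \<eta>(2) gx by (simp add: yi[OF False, symmetric])
        moreover have "(t - y i) * c i (x(i := \<eta>)) = - ((t - y i) * partial i g (x(i := \<eta>)))"
          using False by (simp add: c_def)
        ultimately have "(t - y i) * c i (x(i := \<eta>)) = (s t - x k) * partial k g (p t \<xi>)"
          by linarith
        then have "P t (\<xi>, \<eta>)" using \<xi>(1) \<eta>(1) by (simp only: P_def fst_conv snd_conv)
        then show ?thesis unfolding \<zeta>_def by (rule someI)
      qed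
    qed
    then have evP: "eventually (\<lambda>t. P t (\<zeta> t)) (at (y i))"
      by (simp add: eventually_nhds_conv_at)
    have near': "eventually (\<lambda>t. \<bar>s t - x k\<bar> < e \<and> \<bar>t - y i\<bar> < e) (at (y i))" if "e > 0" for e
      using near[OF that] by (simp add: eventually_nhds_conv_at)
    have lim1: "((\<lambda>t. partial k g (p t (fst (\<zeta> t)))) \<longlongrightarrow> partial k g x) (at (y i))"
    proof (rule tendstoI)
      fix r :: real assume "r > 0"
      from continuous_on_box[OF B(1) smooth_fun_continuous[OF smooth_fun_partial[OF gB BE k] BE] xB this]
      obtain d where d: "d > 0" "\<And>z. z \<in> box_at n x d \<Longrightarrow> \<bar>partial k g z - partial k g x\<bar> < r" by metis
      show "eventually (\<lambda>t. dist (partial k g (p t (fst (\<zeta> t)))) (partial k g x) < r) (at (y i))"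
        using near'[OF d(1)] evP
      proof eventually_elim
        case (elim t)
        then show ?case unfolding dist_real_def by (intro d(2) pbox) (auto simp: P_def)
      qed
    qed
    have lim2: "((\<lambda>t. c i (x(i := snd (\<zeta> t)))) \<longlongrightarrow> c i x) (at (y i))"
    proof (cases "i = k")
      case False
      have "((\<lambda>t. partial i g (x(i := snd (\<zeta> t)))) \<longlongrightarrow> partial i g x) (at (y i))"
      proof (rule tendstoI)
        fix r :: real assume "r > 0"
        from continuous_on_box[OF B(1) smooth_fun_continuous[OF smooth_fun_partial[OF gB BE i] BE] xB this]
        obtain d where d: "d > 0" "\<And>z. z \<in> box_at n x d \<Longrightarrow> \<bar>partial i g z - partial i g x\<bar> < r" by metis
        show "eventually (\<lambda>t. dist (partial i g (x(i := snd (\<zeta> t)))) (partial i g x) < r) (at (y i))"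
          using near'[OF d(1)] evP
        proof eventually_elim
          case (elim t)
          then show ?case unfolding dist_real_def by (intro d(2) qbox[OF _ _ False]) (auto simp: P_def)
        qed
      qed
      then show ?thesis using False by (auto simp: c_def intro: tendsto_minus)
    qed (simp add: c_def)
    have "((\<lambda>t. s t) has_real_derivative c i x / partial k g x) (at (y i))"
      unfolding has_field_derivative_iff
    proof (rule Lim_transform_eventually[OF tendsto_divide[OF lim2 lim1 B(3)[OF xB]]])
      show "eventually (\<lambda>t. c i (x(i := snd (\<zeta> t))) / partial k g (p t (fst (\<zeta> t))) =
          (s t - s (y i)) / (t - y i)) (at (y i))"
        using near'[OF e(1)] evP eventually_neq_at_within[of "y i" "y i" UNIV]
      proof eventually_elim
        case (elim t)
        then have "p t (fst (\<zeta> t)) \<in> B" using pbox e(2) by (auto simp: P_def)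
        then have "partial k g (p t (fst (\<zeta> t))) \<noteq> 0" by (rule B(3))
        then show ?case using elim s0 by (simp add: P_def field_simps)
      qed
    qed
    then show ?thesis by (simp add: s_def x_def)
  qed
  \<comment> \<open>The derivatives of \<open>K\<close> at \<open>y\<close> are expressions in
    \<open>K y\<close>. So the set of all composites of smooth functions on \<open>B\<close> with
    \<open>K\<close> is closed under partial derivatives.\<close>
  have smooth_K: "smooth_fun n W (\<lambda>y. v (K y))" if "smooth_fun n B v" for v
  proof (rule smooth_fun_coinduct[OF W, where R = "{\<lambda>y. v (K y) |v. smooth_fun n B v}"])
    show "(\<lambda>y. v (K y)) \<in> {\<lambda>y. v (K y) |v. smooth_fun n B v}" using that by blast
    fix h assume "h \<in> {\<lambda>y. v (K y) |v. smooth_fun n B v}"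
    then obtain v where v: "smooth_fun n B v" and h: "h = (\<lambda>y. v (K y))" by blast
    show "continuous_on W h"
      unfolding h by (rule continuous_on_compose2[OF smooth_fun_continuous[OF v BE] Kc]) (use KB in blast)
    fix i assume i: "i < n"
    \<comment> \<open>Chain rule: only coordinates \<open>i\<close> and \<open>k\<close> of
      \<open>K\<close> contribute. For \<open>i = k\<close> they are the same one, and the first
      summand is dropped so as not to count it twice.\<close>
    define w where "w x = (if i = k then 0 else partial i v x) + partial k v x * (c i x * inverse (partial k g x))" for x
    have "smooth_fun n B (\<lambda>x. if i = k then 0 else partial i v x)"
      using smooth_fun_partial[OF v BE i] smooth_fun_const[OF B(1)] by (cases "i = k") auto
    moreover have "smooth_fun n B (c i)"
    proof (cases "i = k")
      case True
      then have "c i = (\<lambda>_. 1)" by (simp add: c_def fun_eq_iff)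
      then show ?thesis by (simp add: smooth_fun_const[OF B(1)])
    next
      case False
      then have "c i = (\<lambda>x. 0 - partial i g x)" by (simp add: c_def fun_eq_iff)
      then show ?thesis
        by (simp only: smooth_fun_diff[OF B(1) smooth_fun_const[OF B(1)] smooth_fun_partial[OF gB BE i]])
    qed
    ultimately have "smooth_fun n B w"
      unfolding w_def[abs_def] using B
      by (intro smooth_fun_add smooth_fun_mult smooth_fun_inverse smooth_fun_partial[OF v BE k] smooth_fun_partial[OF gB BE k]) auto
    moreover have "h has_partial i (w (K y)) at y" if y: "y \<in> W" for y
    proof -
      define \<gamma>' where "\<gamma>' j = (if j = k then c i (K y) / partial k g (K y) else if j = i then 1 else 0)" for j
      have ev: "eventually (\<lambda>t. y(i := t) \<in> W) (nhds (y i))"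
        by (rule eventually_fun_upd_mem[OF W y i])
      have "((\<lambda>t. K (y(i := t)) j) has_real_derivative \<gamma>' j) (at (y i))" for j
      proof (cases "j = k")
        case True then show ?thesis using partial_Kk[OF y i] by (simp add: \<gamma>'_def)
      next
        case False
        have ev': "eventually (\<lambda>t. K (y(i := t)) j = (y(i := t)) j) (nhds (y i))"
          using ev by eventually_elim (rule Koff[OF _ False])
        have "((\<lambda>t. (y(i := t)) j) has_real_derivative \<gamma>' j) (at (y i))"
          using False by (auto simp: \<gamma>'_def fun_upd_def)
        then show ?thesis using DERIV_cong_ev[OF refl ev' refl] by simp
      qed
      moreover have "eventually (\<lambda>t. K (y(i := t)) \<in> Rn n) (nhds (y i))"
        using ev by eventually_elim (use KB BE in blast)
      moreover have "K (y(i := y i)) \<in> B" using KB[OF y] by simp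
      ultimately have "((\<lambda>t. v (K (y(i := t)))) has_real_derivative
          (\<Sum>j<n. partial j v (K (y(i := y i))) * \<gamma>' j)) (at (y i))"
        by (intro chain_rule_curve[OF B(1) v]) auto
      moreover have "(\<Sum>j<n. partial j v (K y) * \<gamma>' j) = w (K y)"
      proof -
        have "(\<Sum>j<n. partial j v (K y) * \<gamma>' j) =
          (\<Sum>j<n. (if j = k then partial k v (K y) * (c i (K y) / partial k g (K y)) else 0) +
            (if j = i then (if i = k then 0 else partial i v (K y)) else 0))"
          by (intro sum.cong) (auto simp: \<gamma>'_def)
        also have "\<dots> = w (K y)" using i k by (simp add: sum.distrib w_def field_simps)
        finally show ?thesis .
      qed
      ultimately show ?thesis by (simp add: h)
    qed
    ultimately show "\<exists>h'\<in>{\<lambda>y. v (K y) |v. smooth_fun n B v}. \<forall>y\<in>W. h has_partial i (h' y) at y"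
      by (intro bexI[of _ "\<lambda>y. w (K y)"]) auto
  qed
  have "smooth_map n W n K"
    unfolding smooth_map_def using KB BE smooth_K[OF smooth_fun_coord[OF B(1)]] by auto
  then show thesis
    using that[of B W K] B x0B W KB KG GK by (auto simp: G_def W_def)
qed

text \<open>The components \<open>r 0, \<dots>, r (j - 1)\<close> of \<open>F\<close> are already coordinates; the proof is by
  induction on the number of the remaining ones.\<close>

lemma immersion_left_inverse_normalized:
  assumes "domain m U" "smooth_map m U n F" "x0 \<in> U"
    and "\<And>v. v \<in> Rn m \<Longrightarrow> jacobian m n F x0 v = (\<lambda>_. 0) \<Longrightarrow> v = (\<lambda>_. 0)"
    and "j \<le> m" "\<And>i. i < j \<Longrightarrow> r i < n" "\<And>i x. i < j \<Longrightarrow> x \<in> U \<Longrightarrow> F x (r i) = x i"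
  shows "\<exists>B \<Omega> L. domain m B \<and> x0 \<in> B \<and> B \<subseteq> U \<and> domain n \<Omega> \<and> F \<in> B \<rightarrow> \<Omega> \<and>
    smooth_map n \<Omega> m L \<and> (\<forall>x\<in>B. L (F x) = x)"
  using assms
proof (induction "m - j" arbitrary: j U F x0 r)
  case 0
  then have j: "j = m" by simp
  define L where "L w = (\<lambda>i. if i < m then w (r i) else 0)" for w :: "nat \<Rightarrow> real"
  have "smooth_map n (Rn n) m L"
    unfolding smooth_map_def using smooth_fun_coord[OF domain_Rn] by (auto simp: L_def mem_Rn)
  moreover have "L (F x) = x" if "x \<in> U" for x
  proof
    fix i show "L (F x) i = x i"
      using that 0(8)[of i x] domain_subset[OF 0(2)] j by (auto simp: L_def mem_Rn)
  qed
  ultimately show ?case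
    using 0(2-4) domain_Rn smooth_mapD(1)[OF 0(3)] by (intro exI[of _ U] exI[of _ "Rn n"] exI[of _ L]) auto
next
  case (Suc d)
  note U = Suc.prems(1) and F = Suc.prems(2) and x0 = Suc.prems(3) and ker = Suc.prems(4)
  have j: "j < m" using Suc.hyps(2) by simp
  \<comment> \<open>The image of this unit vector is column \<open>j\<close> of the Jacobian matrix,
    which is nonzero because the kernel is trivial.\<close>
  define e :: "nat \<Rightarrow> real" where "e = (\<lambda>i. if i = j then 1 else 0)"
  have "e \<in> Rn m" "e \<noteq> (\<lambda>_. 0)" using j by (auto simp: e_def mem_Rn fun_eq_iff)
  then have "jacobian m n F x0 e \<noteq> (\<lambda>_. 0)" using ker by blast
  moreover have "(\<Sum>i<m. partial i (\<lambda>y. F y l) x0 * e i) = partial j (\<lambda>y. F y l) x0" for l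
    using j by (simp add: e_def if_distrib cong: if_cong)
  ultimately obtain q where q: "q < n" "partial j (\<lambda>y. F y q) x0 \<noteq> 0"
    by (auto simp: jacobian_def fun_eq_iff split: if_splits)
  define g where "g x = F x q" for x
  have g: "smooth_fun m U g" "partial j g x0 \<noteq> 0"
    using smooth_mapD(2)[OF F q(1)] q(2) by (simp_all add: g_def[abs_def])
  from coordinate_change[OF U g(1) j x0 g(2)]
  obtain B W K where B: "domain m B" "x0 \<in> B" "B \<subseteq> U" and W: "domain m W" and
    K: "smooth_map m W m K" "K \<in> W \<rightarrow> B" and
    G: "\<And>x. x \<in> B \<Longrightarrow> x(j := g x) \<in> W" "\<And>x. x \<in> B \<Longrightarrow> K (x(j := g x)) = x"
      "\<And>y. y \<in> W \<Longrightarrow> (K y)(j := g (K y)) = y" by metis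
  define G where "G x = x(j := g x)" for x
  have Gs: "smooth_map m B m G"
    unfolding G_def using smooth_map_fun_upd[OF B(1) smooth_fun_subset[OF g(1) B(3)] j] .
  \<comment> \<open>\<open>F\<close> in the coordinates \<open>y = G x\<close>; its component
    \<open>q\<close> is coordinate \<open>j\<close>.\<close>
  define F' where "F' y = F (K y)" for y
  define y0 where "y0 = G x0"
  have y0: "y0 \<in> W" "K y0 = x0" using G B(2) by (auto simp: y0_def G_def)
  have F': "smooth_map m W n F'"
    unfolding F'_def using K(2) B(3) by (intro smooth_map_compose[OF K(1) W _ U F]) auto
  have "\<exists>B' \<Omega> L. domain m B' \<and> y0 \<in> B' \<and> B' \<subseteq> W \<and> domain n \<Omega> \<and> F' \<in> B' \<rightarrow> \<Omega> \<and>
    smooth_map n \<Omega> m L \<and> (\<forall>x\<in>B'. L (F' x) = x)"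
  proof (rule Suc.hyps(1)[where j = "Suc j" and r = "r(j := q)"])
    show "d = m - Suc j" using Suc.hyps(2) by simp
    show "Suc j \<le> m" using j by simp
    show "(r(j := q)) i < n" if "i < Suc j" for i
      using that q(1) Suc.prems(6) by auto
    show "F' y ((r(j := q)) i) = y i" if "i < Suc j" "y \<in> W" for i y
    proof (cases "i = j")
      case True
      then show ?thesis using fun_cong[OF G(3)[OF that(2)], of j] by (simp add: F'_def g_def)
    next
      case False
      \<comment> \<open>\<open>K\<close> changes only coordinate \<open>j\<close>, so the components
        treated earlier keep their normal form.\<close>
      then have "F' y (r i) = K y i"
        unfolding F'_def using that K(2) B(3) by (intro Suc.prems(7)) auto
      then show ?thesis using False fun_cong[OF G(3)[OF that(2)], of i] by simp
    qed
    \<comment> \<open>The trivial kernel survives the change of coordinates: the Jacobian of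
      \<open>K\<close> sends \<open>v\<close> into the kernel for \<open>F\<close>, hence to 0, and
      it is injective because \<open>G (K y) = y\<close> on \<open>W\<close>.\<close>
    show "v = (\<lambda>_. 0)" if v: "v \<in> Rn m" "jacobian m n F' y0 v = (\<lambda>_. 0)" for v
    proof -
      have "jacobian m n F' y0 v = jacobian m n F (K y0) (jacobian m m K y0 v)"
        unfolding F'_def using K(2) B(3) by (intro jacobian_compose[OF K(1) W _ U F y0(1)]) auto
      then have *: "jacobian m m K y0 v = (\<lambda>_. 0)"
        using v(2) y0(2) ker jacobian_mem_Rn by metis
      have "v = jacobian m m (\<lambda>y. y) y0 v" using jacobian_id[OF v(1)] by simp
      also have "\<dots> = jacobian m m (\<lambda>y. G (K y)) y0 v"
        using G(3) by (intro jacobian_cong[OF W y0(1)]) (simp add: G_def)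
      also have "\<dots> = jacobian m m G (K y0) (jacobian m m K y0 v)"
        by (rule jacobian_compose[OF K(1) W K(2) B(1) Gs y0(1)])
      finally show ?thesis by (simp add: * jacobian_zero)
    qed
  qed (use W F' y0 in auto)
  then obtain B' \<Omega> L where B': "domain m B'" "y0 \<in> B'" "B' \<subseteq> W" and \<Omega>: "domain n \<Omega>" and
    F'\<Omega>: "F' \<in> B' \<rightarrow> \<Omega>" and L: "smooth_map n \<Omega> m L" "\<And>y. y \<in> B' \<Longrightarrow> L (F' y) = y" by blast
  \<comment> \<open>\<open>L\<close> has values in \<open>Rn m\<close>, while \<open>K\<close> is
    smooth on \<open>W\<close> only.\<close>
  define \<Omega>' where "\<Omega>' = {w \<in> \<Omega>. L w \<in> W}"
  have \<Omega>': "domain n \<Omega>'"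
    unfolding \<Omega>'_def by (rule domain_preimage[OF \<Omega> smooth_map_continuous[OF L(1) domain_subset[OF \<Omega>]] smooth_mapD(1)[OF L(1)] W])
  define B'' where "B'' = {x \<in> B. G x \<in> B'}"
  have B'': "domain m B''"
    unfolding B''_def by (rule domain_preimage[OF B(1) smooth_map_continuous[OF Gs domain_subset[OF B(1)]] smooth_mapD(1)[OF Gs] B'(1)])
  have FG: "F x = F' (G x)" "K (G x) = x" if "x \<in> B''" for x
    using that G(2) by (auto simp: F'_def G_def B''_def)
  have LG: "L (F x) = G x" if "x \<in> B''" for x
    using FG(1)[OF that] L(2) that by (simp add: B''_def)
  have "smooth_map n \<Omega>' m (\<lambda>w. K (L w))"
    using smooth_map_subset[OF L(1), of \<Omega>'] by (intro smooth_map_compose[OF _ \<Omega>' _ W K(1)]) (auto simp: \<Omega>'_def)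
  moreover have "F x \<in> \<Omega>'" if "x \<in> B''" for x
    using that FG(1)[OF that] LG[OF that] F'\<Omega> B'(3) by (auto simp: \<Omega>'_def B''_def)
  ultimately show ?case
    using B'' B(2,3) B'(2) \<Omega>' LG FG(2)
    by (intro exI[of _ B''] exI[of _ \<Omega>'] exI[of _ "\<lambda>w. K (L w)"]) (auto simp: B''_def y0_def)
qed


section \<open>Charts\<close>

lemma domain_local:
  assumes "\<And>x. x \<in> S \<Longrightarrow> \<exists>W. domain n W \<and> x \<in> W \<and> W \<subseteq> S"
  shows "domain n S"
  using assms unfolding domain_def by (subst openin_subopen) blast

lemma domain_preimage_map:
  assumes "domain n U" "continuous_map (subtopology (Euclidean_space n) U) X P" "openin X S"
  shows "domain n {x \<in> U. P x \<in> S}"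
proof -
  have "openin (subtopology (Euclidean_space n) U) {x \<in> topspace (subtopology (Euclidean_space n) U). P x \<in> S}"
    using assms(2,3) by (rule openin_continuous_map_preimage)
  then have "openin (subtopology (Euclidean_space n) U) {x \<in> U. P x \<in> S}"
    using domain_subset[OF assms(1)] by (simp add: inf.absorb2)
  then show ?thesis using assms(1) openin_trans_full unfolding domain_def by blast
qed

definition chart_inv :: "'a chart \<Rightarrow> (nat \<Rightarrow> real) \<Rightarrow> 'a"
  where "chart_inv c = inv_into (fst c) (snd c)"

abbreviation chart_image :: "'a chart \<Rightarrow> (nat \<Rightarrow> real) set"
  where "chart_image c \<equiv> snd c ` fst c"

lemma chart_facts:
  assumes "smooth_manifold M" "c \<in> atlas M"
  shows chart_open: "openin (mtop M) (fst c)"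
    and chart_domain: "domain (mdim M) (chart_image c)"
    and chart_homeo: "homeomorphic_map (subtopology (mtop M) (fst c))
         (subtopology (Euclidean_space (mdim M)) (chart_image c)) (snd c)"
  using assms unfolding smooth_manifold_def by (auto simp: case_prod_unfold)

lemma chart_subset:
  assumes "smooth_manifold M" "c \<in> atlas M"
  shows "fst c \<subseteq> topspace (mtop M)"
  by (rule openin_subset[OF chart_open[OF assms]])

lemma chart_inv:
  assumes "smooth_manifold M" "c \<in> atlas M"
  shows chart_inv_chart: "p \<in> fst c \<Longrightarrow> chart_inv c (snd c p) = p"
    and chart_chart_inv: "y \<in> chart_image c \<Longrightarrow> snd c (chart_inv c y) = y"
    and chart_inv_mem: "y \<in> chart_image c \<Longrightarrow> chart_inv c y \<in> fst c"
proof -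
  have "inj_on (snd c) (fst c)"
    using homeomorphic_imp_injective_map[OF chart_homeo[OF assms]] chart_subset[OF assms]
    by (simp add: inf.absorb2)
  then show "p \<in> fst c \<Longrightarrow> chart_inv c (snd c p) = p" by (simp add: chart_inv_def)
  show "y \<in> chart_image c \<Longrightarrow> snd c (chart_inv c y) = y" by (simp add: chart_inv_def f_inv_into_f)
  show "y \<in> chart_image c \<Longrightarrow> chart_inv c y \<in> fst c" by (simp add: chart_inv_def inv_into_into)
qed

lemma chart_continuous:
  assumes "smooth_manifold M" "c \<in> atlas M"
  shows "continuous_map (subtopology (mtop M) (fst c)) (Euclidean_space (mdim M)) (snd c)"
  using homeomorphic_imp_continuous_map[OF chart_homeo[OF assms]]
  by (rule continuous_map_into_fulltopology)

lemma chart_inv_continuous: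
  assumes "smooth_manifold M" "c \<in> atlas M"
  shows "continuous_map (subtopology (Euclidean_space (mdim M)) (chart_image c)) (mtop M) (chart_inv c)"
proof -
  note im = domain_subset[OF chart_domain[OF assms]]
  from chart_homeo[OF assms] obtain g where g: "homeomorphic_maps (subtopology (mtop M) (fst c))
         (subtopology (Euclidean_space (mdim M)) (chart_image c)) (snd c) g"
    unfolding homeomorphic_map_maps by blast
  then have "continuous_map (subtopology (Euclidean_space (mdim M)) (chart_image c)) (mtop M) g"
    unfolding homeomorphic_maps_def using continuous_map_into_fulltopology by blast
  then show ?thesis
  proof (rule continuous_map_eq)
    fix y assume "y \<in> topspace (subtopology (Euclidean_space (mdim M)) (chart_image c))"
    then obtain p where "p \<in> fst c" "y = snd c p" by auto
    moreover from this have "g (snd c p) = p"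
      using g chart_subset[OF assms] by (auto simp: homeomorphic_maps_def)
    ultimately show "g y = chart_inv c y" using chart_inv_chart[OF assms] by simp
  qed
qed

lemma chart_preimage_open:
  assumes "smooth_manifold M" "c \<in> atlas M" "domain (mdim M) D"
  shows "openin (mtop M) {p \<in> fst c. snd c p \<in> D}"
proof -
  have "openin (subtopology (mtop M) (fst c)) {p \<in> topspace (subtopology (mtop M) (fst c)). snd c p \<in> D}"
    using assms(3) unfolding domain_def
    by (rule openin_continuous_map_preimage[OF chart_continuous[OF assms(1,2)]])
  then have "openin (subtopology (mtop M) (fst c)) {p \<in> fst c. snd c p \<in> D}"
    using chart_subset[OF assms(1,2)] by (simp add: inf.absorb2)
  then show ?thesis using chart_open[OF assms(1,2)] openin_trans_full by blast
qed

lemma chart_image_open: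
  assumes "smooth_manifold M" "c \<in> atlas M" "openin (mtop M) S"
  shows "domain (mdim M) (snd c ` (fst c \<inter> S))"
proof -
  have "snd c ` (fst c \<inter> S) = {y \<in> chart_image c. chart_inv c y \<in> S}"
    using chart_inv[OF assms(1,2)] by force
  then show ?thesis
    using domain_preimage_map[OF chart_domain[OF assms(1,2)] chart_inv_continuous[OF assms(1,2)] assms(3)]
    by simp
qed

lemma obtain_chart:
  assumes "smooth_manifold M" "p \<in> topspace (mtop M)"
  obtains c where "c \<in> atlas M" "p \<in> fst c"
  using assms unfolding smooth_manifold_def by blast

lemma local_rep_eq: "local_rep c d f y = snd d (f (chart_inv c y))"
  by (simp add: local_rep_def chart_inv_def)

lemma local_rep_chart:
  assumes "smooth_manifold M" "c \<in> atlas M" "p \<in> fst c"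
  shows "local_rep c d f (snd c p) = snd d (f p)"
  using chart_inv_chart[OF assms] by (simp add: local_rep_eq)

lemma local_dom_eq:
  assumes "smooth_manifold M" "c \<in> atlas M"
  shows "local_dom c d f = {y \<in> chart_image c. f (chart_inv c y) \<in> fst d}"
  using chart_inv[OF assms] by (force simp: local_dom_def)

lemma chart_mem_local_dom:
  assumes "smooth_manifold M" "c \<in> atlas M" "p \<in> fst c"
  shows "snd c p \<in> local_dom c d f \<longleftrightarrow> f p \<in> fst d"
  using assms(3) chart_inv_chart[OF assms] by (simp add: local_dom_eq[OF assms(1,2)])

lemma domain_local_dom:
  assumes "smooth_manifold M" "c \<in> atlas M" "smooth_manifold N" "d \<in> atlas N" "continuous_map (mtop M) (mtop N) f"
  shows "domain (mdim M) (local_dom c d f)"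
proof -
  have "openin (mtop M) {p \<in> topspace (mtop M). f p \<in> fst d}"
    by (rule openin_continuous_map_preimage[OF assms(5) chart_open[OF assms(3,4)]])
  from chart_image_open[OF assms(1,2) this]
  have "domain (mdim M) (snd c ` (fst c \<inter> {p \<in> topspace (mtop M). f p \<in> fst d}))" .
  moreover have "fst c \<inter> {p \<in> topspace (mtop M). f p \<in> fst d} = {p \<in> fst c. f p \<in> fst d}"
    using chart_subset[OF assms(1,2)] by blast
  ultimately show ?thesis by (simp only: local_dom_def)
qed

lemma smooth_manifold_map_id: "smooth_manifold M \<Longrightarrow> smooth_manifold_map M M (\<lambda>p. p)"
  by (simp add: smooth_manifold_map_def smooth_manifold_def)

lemma smooth_manifold_mapD:
  assumes "smooth_manifold_map M N f"
  shows "continuous_map (mtop M) (mtop N) f"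
    and "c \<in> atlas M \<Longrightarrow> d \<in> atlas N \<Longrightarrow> smooth_map (mdim M) (local_dom c d f) (mdim N) (local_rep c d f)"
  using assms by (auto simp: smooth_manifold_map_def)


section \<open>Plots of manifolds\<close>

text \<open>The identity is the only chart of the source domain, so its local representatives are
  the maps \<open>snd d\<close> after \<open>P\<close>. Only openness of the chart sets is assumed,
  which lets the lemma apply to \<open>domain_manifold\<close> directly.\<close>

lemma plots_standard_iff:
  assumes "\<And>d. d \<in> atlas M \<Longrightarrow> openin (mtop M) (fst d)"
  shows "(n, U, P) \<in> plots (standard_diff M) \<longleftrightarrow> domain n U \<and> P \<in> U \<rightarrow>\<^sub>E topspace (mtop M) \<and>
    continuous_map (subtopology (Euclidean_space n) U) (mtop M) P \<and>
    (\<forall>d\<in>atlas M. smooth_map n {x \<in> U. P x \<in> fst d} (mdim M) (\<lambda>x. snd d (P x)))"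
proof -
  have inv: "inv_into U (\<lambda>x. x) y = y" if "y \<in> U" for y
    using inv_into_f_f[of "\<lambda>x. x" U y] that by (simp add: inj_on_def)
  have dom: "local_dom (U, \<lambda>x. x) d P = {x \<in> U. P x \<in> fst d}" for d :: "'a chart"
    by (simp add: local_dom_def)
  have "smooth_map n (local_dom (U, \<lambda>x. x) d P) (mdim M) (local_rep (U, \<lambda>x. x) d P) \<longleftrightarrow>
    smooth_map n {x \<in> U. P x \<in> fst d} (mdim M) (\<lambda>x. snd d (P x))"
    if "domain n U" "continuous_map (subtopology (Euclidean_space n) U) (mtop M) P" "d \<in> atlas M" for d
  proof -
    have D: "domain n {x \<in> U. P x \<in> fst d}"
      by (rule domain_preimage_map[OF that(1,2) assms[OF that(3)]])
    have eq: "local_rep (U, \<lambda>x. x) d P x = snd d (P x)" if "x \<in> {x \<in> U. P x \<in> fst d}" for x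
      using that inv by (simp add: local_rep_def)
    show ?thesis
      unfolding dom using eq smooth_map_cong[OF D, of "local_rep (U, \<lambda>x. x) d P" "\<lambda>x. snd d (P x)"]
        smooth_map_cong[OF D, of "\<lambda>x. snd d (P x)" "local_rep (U, \<lambda>x. x) d P"] by auto
  qed
  then show ?thesis
    by (auto simp: standard_diff_def parametrizations_def smooth_manifold_map_def domain_manifold_def)
qed

lemma plots_manifold_iff:
  assumes "smooth_manifold M"
  shows "(n, U, P) \<in> plots (standard_diff M) \<longleftrightarrow> domain n U \<and> P \<in> U \<rightarrow>\<^sub>E topspace (mtop M) \<and>
    continuous_map (subtopology (Euclidean_space n) U) (mtop M) P \<and>
    (\<forall>d\<in>atlas M. smooth_map n {x \<in> U. P x \<in> fst d} (mdim M) (\<lambda>x. snd d (P x)))"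
  by (rule plots_standard_iff[OF chart_open[OF assms]])

lemma points_standard_diff: "points (standard_diff M) = topspace (mtop M)"
  by (simp add: standard_diff_def)

lemma plotD:
  assumes "smooth_manifold M" "(n, U, P) \<in> plots (standard_diff M)"
  shows "domain n U" "P \<in> U \<rightarrow>\<^sub>E topspace (mtop M)"
    "continuous_map (subtopology (Euclidean_space n) U) (mtop M) P"
    "d \<in> atlas M \<Longrightarrow> smooth_map n {x \<in> U. P x \<in> fst d} (mdim M) (\<lambda>x. snd d (P x))"
    "d \<in> atlas M \<Longrightarrow> domain n {x \<in> U. P x \<in> fst d}"
proof -
  note * = plots_manifold_iff[OF assms(1), THEN iffD1, OF assms(2)]
  show 1: "domain n U" "P \<in> U \<rightarrow>\<^sub>E topspace (mtop M)"
    "continuous_map (subtopology (Euclidean_space n) U) (mtop M) P"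
    "d \<in> atlas M \<Longrightarrow> smooth_map n {x \<in> U. P x \<in> fst d} (mdim M) (\<lambda>x. snd d (P x))"
    using * by auto
  show "d \<in> atlas M \<Longrightarrow> domain n {x \<in> U. P x \<in> fst d}"
    by (rule domain_preimage_map[OF 1(1,3) chart_open[OF assms(1)]])
qed

text \<open>One chart around each point is enough: transition maps carry smoothness to every other
  chart, and continuity can be read off in the given one.\<close>

lemma plotI:
  assumes M: "smooth_manifold M" and U: "domain n U" and P: "P \<in> U \<rightarrow>\<^sub>E topspace (mtop M)"
    and loc: "\<And>x. x \<in> U \<Longrightarrow> \<exists>W c. domain n W \<and> x \<in> W \<and> W \<subseteq> U \<and> c \<in> atlas M \<and> P ` W \<subseteq> fst c \<and>
      smooth_map n W (mdim M) (\<lambda>z. snd c (P z))"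
  shows "(n, U, P) \<in> plots (standard_diff M)"
  unfolding plots_manifold_iff[OF M]
proof (intro conjI ballI U P)
  have preimage: "domain n {x \<in> U. P x \<in> T}" if T: "openin (mtop M) T" for T
  proof (rule domain_local)
    fix x assume x: "x \<in> {x \<in> U. P x \<in> T}"
    then obtain W c where W: "domain n W" "x \<in> W" "W \<subseteq> U" and c: "c \<in> atlas M" "P ` W \<subseteq> fst c"
      "smooth_map n W (mdim M) (\<lambda>z. snd c (P z))" using loc[of x] by auto
    have "domain n {z \<in> W. snd c (P z) \<in> snd c ` (fst c \<inter> T)}"
      by (rule domain_preimage[OF W(1) smooth_map_continuous[OF c(3) domain_subset[OF W(1)]]
          smooth_mapD(1)[OF c(3)] chart_image_open[OF M c(1) T]])
    \<comment> \<open>\<open>P\<close> maps \<open>W\<close> into the chart set, where the chart is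
      injective.\<close>
    moreover have "{z \<in> W. snd c (P z) \<in> snd c ` (fst c \<inter> T)} = {z \<in> W. P z \<in> T}"
    proof (intro Collect_cong conj_cong refl iffI)
      fix z assume z: "z \<in> W" "snd c (P z) \<in> snd c ` (fst c \<inter> T)"
      then obtain q where "q \<in> fst c" "q \<in> T" "snd c (P z) = snd c q" by auto
      moreover have "P z \<in> fst c" using z(1) c(2) by auto
      ultimately show "P z \<in> T" using chart_inv_chart[OF M c(1)] by metis
    qed (use c(2) in auto)
    ultimately show "\<exists>W. domain n W \<and> x \<in> W \<and> W \<subseteq> {x \<in> U. P x \<in> T}"
      using W x by (intro exI[of _ "{z \<in> W. P z \<in> T}"]) auto
  qed
  show "continuous_map (subtopology (Euclidean_space n) U) (mtop M) P"
    unfolding continuous_map_def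
  proof (intro conjI allI impI)
    show "P \<in> topspace (subtopology (Euclidean_space n) U) \<rightarrow> topspace (mtop M)" using P by auto
    fix T assume "openin (mtop M) T"
    from preimage[OF this] show "openin (subtopology (Euclidean_space n) U)
        {x \<in> topspace (subtopology (Euclidean_space n) U). P x \<in> T}"
      using domain_subset[OF U] U unfolding domain_def
      by (auto simp: openin_open_subtopology inf.absorb2)
  qed
  fix d assume d: "d \<in> atlas M"
  have D: "domain n {x \<in> U. P x \<in> fst d}" by (rule preimage[OF chart_open[OF M d]])
  show "smooth_map n {x \<in> U. P x \<in> fst d} (mdim M) (\<lambda>x. snd d (P x))"
  proof (rule smooth_map_local[OF D])
    fix x assume x: "x \<in> {x \<in> U. P x \<in> fst d}"
    then obtain W c where W: "domain n W" "x \<in> W" "W \<subseteq> U" and c: "c \<in> atlas M" "P ` W \<subseteq> fst c"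
      "smooth_map n W (mdim M) (\<lambda>z. snd c (P z))" using loc[of x] by auto
    define W' where "W' = W \<inter> {x \<in> U. P x \<in> fst d}"
    have W': "domain n W'" unfolding W'_def by (rule domain_Int[OF W(1) D])
    have PW: "P z \<in> fst c" "P z \<in> fst d" if "z \<in> W'" for z
      using that c(2) by (auto simp: W'_def)
    have "smooth_map n W' (mdim M) (\<lambda>z. local_rep c d (\<lambda>p. p) (snd c (P z)))"
    proof (rule smooth_map_compose[OF smooth_map_subset[OF c(3)] W'])
      show "W' \<subseteq> W" by (auto simp: W'_def)
      show "(\<lambda>z. snd c (P z)) \<in> W' \<rightarrow> local_dom c d (\<lambda>p. p)"
        using PW by (auto simp: local_dom_def)
      show "domain (mdim M) (local_dom c d (\<lambda>p. p))"
        by (rule domain_local_dom[OF M c(1) M d]) simp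
      show "smooth_map (mdim M) (local_dom c d (\<lambda>p. p)) (mdim M) (local_rep c d (\<lambda>p. p))"
        by (rule smooth_manifold_mapD(2)[OF smooth_manifold_map_id[OF M] c(1) d])
    qed
    then have "smooth_map n W' (mdim M) (\<lambda>z. snd d (P z))"
      by (rule smooth_map_cong[OF W', rotated]) (simp add: local_rep_chart[OF M c(1)] PW)
    then show "\<exists>W. domain n W \<and> x \<in> W \<and> smooth_map n W (mdim M) (\<lambda>x. snd d (P x))"
      using W' W(2) x by (intro exI[of _ W']) (auto simp: W'_def)
  qed
qed

lemma plot_compose:
  assumes M: "smooth_manifold M" and P: "(n, U, P) \<in> plots (standard_diff M)"
    and V: "domain m V" and F: "F \<in> V \<rightarrow> U" "smooth_map m V n F"
  shows "(m, V, compose V P F) \<in> plots (standard_diff M)"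
proof (rule plotI[OF M V])
  note P' = plotD[OF M P]
  show "compose V P F \<in> V \<rightarrow>\<^sub>E topspace (mtop M)"
    using P'(2) F(1) by (auto simp: compose_def)
  fix x assume x: "x \<in> V"
  then have "P (F x) \<in> topspace (mtop M)" using P'(2) F(1) by auto
  then obtain c where c: "c \<in> atlas M" "P (F x) \<in> fst c" using obtain_chart[OF M] by metis
  define W where "W = {z \<in> V. F z \<in> {u \<in> U. P u \<in> fst c}}"
  have W: "domain m W"
    unfolding W_def by (rule domain_preimage[OF V smooth_map_continuous[OF F(2) domain_subset[OF V]]
        smooth_mapD(1)[OF F(2)] P'(5)[OF c(1)]])
  have "smooth_map m W (mdim M) (\<lambda>z. snd c (P (F z)))"
    by (rule smooth_map_compose[OF smooth_map_subset[OF F(2)] W _ P'(5,4)[OF c(1)]]) (auto simp: W_def)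
  then have "smooth_map m W (mdim M) (\<lambda>z. snd c (compose V P F z))"
    by (rule smooth_map_cong[OF W, rotated]) (simp add: compose_def W_def)
  then show "\<exists>W c. domain m W \<and> x \<in> W \<and> W \<subseteq> V \<and> c \<in> atlas M \<and> compose V P F ` W \<subseteq> fst c \<and>
      smooth_map m W (mdim M) (\<lambda>z. snd c (compose V P F z))"
    using W c x F(1) by (intro exI[of _ W] exI[of _ c]) (auto simp: W_def compose_def)
qed

text \<open>A 0-dimensional plot through each point, for the covering axiom.\<close>

lemma const_plot:
  assumes "smooth_manifold M" "p \<in> topspace (mtop M)"
  shows "(0, Rn 0, \<lambda>x\<in>Rn 0. p) \<in> plots (standard_diff M)"
proof (rule plotI[OF assms(1) domain_Rn])
  show "(\<lambda>x\<in>Rn 0. p) \<in> Rn 0 \<rightarrow>\<^sub>E topspace (mtop M)" using assms(2) by auto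
  obtain c where c: "c \<in> atlas M" "p \<in> fst c" using obtain_chart[OF assms] .
  have "snd c p \<in> Rn (mdim M)" using domain_subset[OF chart_domain[OF assms(1) c(1)]] c(2) by auto
  then have "smooth_map 0 (Rn 0) (mdim M) (\<lambda>z. snd c p)"
    unfolding smooth_map_def using smooth_fun_const[OF domain_Rn] by auto
  then have "smooth_map 0 (Rn 0) (mdim M) (\<lambda>z. snd c ((\<lambda>x\<in>Rn 0. p) z))"
    by (rule smooth_map_cong[OF domain_Rn, rotated]) simp
  then show "\<exists>W c. domain 0 W \<and> x \<in> W \<and> W \<subseteq> Rn 0 \<and> c \<in> atlas M \<and> (\<lambda>x\<in>Rn 0. p) ` W \<subseteq> fst c \<and>
      smooth_map 0 W (mdim M) (\<lambda>z. snd c ((\<lambda>x\<in>Rn 0. p) z))" if "x \<in> Rn 0" for x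
    using that c domain_Rn by (intro exI[of _ "Rn 0"] exI[of _ c]) auto
qed

text \<open>Read in its own chart, an inverse chart is the identity. These plots test smoothness of
  maps out of \<open>M\<close> and serve as test plots for diffeological immersions.\<close>

lemma chart_inv_plot:
  assumes "smooth_manifold M" "c \<in> atlas M"
  shows "(mdim M, chart_image c, restrict (chart_inv c) (chart_image c)) \<in> plots (standard_diff M)"
proof (rule plotI[OF assms(1) chart_domain[OF assms]])
  show "restrict (chart_inv c) (chart_image c) \<in> chart_image c \<rightarrow>\<^sub>E topspace (mtop M)"
    using chart_inv_mem[OF assms] chart_subset[OF assms] by auto
  have "smooth_map (mdim M) (chart_image c) (mdim M) (\<lambda>z. snd c (restrict (chart_inv c) (chart_image c) z))"
    by (rule smooth_map_cong[OF chart_domain[OF assms] _ smooth_map_id[OF chart_domain[OF assms]]])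
      (simp add: chart_chart_inv[OF assms])
  then show "\<exists>W d. domain (mdim M) W \<and> x \<in> W \<and> W \<subseteq> chart_image c \<and> d \<in> atlas M \<and>
      restrict (chart_inv c) (chart_image c) ` W \<subseteq> fst d \<and>
      smooth_map (mdim M) W (mdim M) (\<lambda>z. snd d (restrict (chart_inv c) (chart_image c) z))"
    if "x \<in> chart_image c" for x
    using that chart_domain[OF assms] assms(2) chart_inv_mem[OF assms]
    by (intro exI[of _ "chart_image c"] exI[of _ c]) auto
qed

text \<open>The gluing axiom holds because \<open>plotI\<close> asks for smoothness only near each
  point.\<close>

lemma diffeological_space_standard_diff:
  assumes M: "smooth_manifold M"
  shows "diffeological_space (standard_diff M)"
  unfolding diffeological_space_def
proof (intro conjI)
  show "plots (standard_diff M) \<subseteq> parametrizations (points (standard_diff M))"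
  proof clarify
    fix n U P assume "(n, U, P) \<in> plots (standard_diff M)"
    from plotD(1,2)[OF M this] show "(n, U, P) \<in> parametrizations (points (standard_diff M))"
      by (simp add: parametrizations_def points_standard_diff)
  qed
  show "(\<Union>(n, U, P)\<in>plots (standard_diff M). P ` U) = points (standard_diff M)"
  proof (intro equalityI subsetI)
    fix p assume "p \<in> points (standard_diff M)"
    then have "(0, Rn 0, \<lambda>x\<in>Rn 0. p) \<in> plots (standard_diff M)"
      using const_plot[OF M] by (simp add: points_standard_diff)
    moreover have "p \<in> (\<lambda>x\<in>Rn 0. p) ` Rn 0" by (auto simp: mem_Rn image_iff)
    ultimately show "p \<in> (\<Union>(n, U, P)\<in>plots (standard_diff M). P ` U)" by blast
  qed (use plotD(2)[OF M] in \<open>fastforce simp: points_standard_diff\<close>)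
  show "\<forall>(n, U, P)\<in>plots (standard_diff M). \<forall>m V F. domain m V \<and> F \<in> V \<rightarrow> U \<and> smooth_map m V n F \<longrightarrow>
      (m, V, compose V P F) \<in> plots (standard_diff M)"
    using plot_compose[OF M] by blast
  show "\<forall>n \<F>. (\<forall>(U, P)\<in>\<F>. (n, U, P) \<in> plots (standard_diff M)) \<and>
        (\<forall>(U, P)\<in>\<F>. \<forall>(V, Q)\<in>\<F>. \<forall>x\<in>U \<inter> V. P x = Q x) \<longrightarrow>
        (\<forall>W R. W = (\<Union>(U, P)\<in>\<F>. U) \<and> R \<in> W \<rightarrow>\<^sub>E points (standard_diff M) \<and>
          (\<forall>(U, P)\<in>\<F>. \<forall>x\<in>U. R x = P x) \<longrightarrow> (n, W, R) \<in> plots (standard_diff M))"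
  proof (intro allI impI)
    fix n W R and \<F> :: "((nat \<Rightarrow> real) set \<times> ((nat \<Rightarrow> real) \<Rightarrow> 'a)) set"
    assume "(\<forall>(U, P)\<in>\<F>. (n, U, P) \<in> plots (standard_diff M)) \<and>
        (\<forall>(U, P)\<in>\<F>. \<forall>(V, Q)\<in>\<F>. \<forall>x\<in>U \<inter> V. P x = Q x)"
      and "W = (\<Union>(U, P)\<in>\<F>. U) \<and> R \<in> W \<rightarrow>\<^sub>E points (standard_diff M) \<and> (\<forall>(U, P)\<in>\<F>. \<forall>x\<in>U. R x = P x)"
    then have plot: "\<And>U P. (U, P) \<in> \<F> \<Longrightarrow> (n, U, P) \<in> plots (standard_diff M)"
      and W: "W = (\<Union>(U, P)\<in>\<F>. U)" and R: "R \<in> W \<rightarrow>\<^sub>E topspace (mtop M)"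
      and RP: "\<And>U P x. (U, P) \<in> \<F> \<Longrightarrow> x \<in> U \<Longrightarrow> R x = P x"
      by (auto simp: points_standard_diff)
    have "domain n W"
      unfolding W using plotD(1)[OF M plot] by (intro domain_UN) auto
    then show "(n, W, R) \<in> plots (standard_diff M)"
    proof (rule plotI[OF M _ R])
      fix x assume "x \<in> W"
      then obtain U P where UP: "(U, P) \<in> \<F>" "x \<in> U" unfolding W by auto
      note P = plotD[OF M plot[OF UP(1)]]
      obtain c where c: "c \<in> atlas M" "P x \<in> fst c"
        using obtain_chart[OF M, of "P x"] P(2) UP(2) by auto
      have "smooth_map n {z \<in> U. P z \<in> fst c} (mdim M) (\<lambda>z. snd c (R z))"
        by (rule smooth_map_cong[OF P(5)[OF c(1)] _ P(4)[OF c(1)]]) (simp add: RP[OF UP(1)])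
      then show "\<exists>V c. domain n V \<and> x \<in> V \<and> V \<subseteq> W \<and> c \<in> atlas M \<and> R ` V \<subseteq> fst c \<and>
          smooth_map n V (mdim M) (\<lambda>z. snd c (R z))"
        using P(5)[OF c(1)] c UP RP[OF UP(1)] unfolding W
        by (intro exI[of _ "{z \<in> U. P z \<in> fst c}"] exI[of _ c]) auto
    qed
  qed
qed

lemma plots_domain_diff_iff:
  assumes "domain n U"
  shows "(k, Z, Q) \<in> plots (domain_diff n U) \<longleftrightarrow> domain k Z \<and> Q \<in> Z \<rightarrow>\<^sub>E U \<and> smooth_map k Z n Q"
proof -
  have top: "topspace (subtopology (Euclidean_space n) U) = U"
    using domain_subset[OF assms] by auto
  have "(k, Z, Q) \<in> plots (domain_diff n U) \<longleftrightarrow> domain k Z \<and> Q \<in> Z \<rightarrow>\<^sub>E U \<and>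
    continuous_map (subtopology (Euclidean_space k) Z) (subtopology (Euclidean_space n) U) Q \<and>
    smooth_map k {x \<in> Z. Q x \<in> U} n (\<lambda>x. Q x)"
    unfolding domain_diff_def
    using openin_topspace[of "subtopology (Euclidean_space n) U", unfolded top] top
    by (subst plots_standard_iff) (auto simp: domain_manifold_def)
  moreover have "{x \<in> Z. Q x \<in> U} = Z" if "Q \<in> Z \<rightarrow>\<^sub>E U" using that by auto
  moreover have "continuous_map (subtopology (Euclidean_space k) Z) (subtopology (Euclidean_space n) U) Q"
    if "smooth_map k Z n Q" "domain k Z" "Q \<in> Z \<rightarrow>\<^sub>E U"
    using that smooth_map_continuous[OF that(1) domain_subset[OF that(2)]] smooth_mapD(1)[OF that(1)]
    unfolding continuous_map_in_subtopology
    by (subst continuous_map_domain_Euclidean_iff[OF domain_subset[OF that(2)]]) auto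
  ultimately show ?thesis by auto
qed

lemma points_domain_diff: "domain n U \<Longrightarrow> points (domain_diff n U) = U"
  using domain_subset by (auto simp: domain_diff_def points_standard_diff domain_manifold_def)

text \<open>From right to left, a plot followed by \<open>f\<close> is smooth in charts. From left
  to right, \<open>f\<close> after an inverse chart is a plot of \<open>N\<close>, which gives both
  continuity and smooth local representatives.\<close>

lemma dsmooth_iff_smooth_manifold_map:
  assumes M: "smooth_manifold M" and N: "smooth_manifold N" and f: "f \<in> topspace (mtop M) \<rightarrow> topspace (mtop N)"
  shows "dsmooth (standard_diff M) (standard_diff N) f \<longleftrightarrow> smooth_manifold_map M N f"
proof
  assume fs: "smooth_manifold_map M N f"
  note fD = smooth_manifold_mapD[OF fs]
  show "dsmooth (standard_diff M) (standard_diff N) f"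
    unfolding dsmooth_def
  proof (safe)
    show "f x \<in> points (standard_diff N)" if "x \<in> points (standard_diff M)" for x
      using that f by (auto simp: points_standard_diff)
    fix n U P assume "(n, U, P) \<in> plots (standard_diff M)"
    note P = plotD[OF M this]
    show "(n, U, compose U f P) \<in> plots (standard_diff N)"
    proof (rule plotI[OF N P(1)])
      show "compose U f P \<in> U \<rightarrow>\<^sub>E topspace (mtop N)" using P(2) f by (auto simp: compose_def)
      fix x assume x: "x \<in> U"
      then have px: "P x \<in> topspace (mtop M)" "f (P x) \<in> topspace (mtop N)" using P(2) f by auto
      obtain c where c: "c \<in> atlas M" "P x \<in> fst c" using obtain_chart[OF M px(1)] .
      obtain d where d: "d \<in> atlas N" "f (P x) \<in> fst d" using obtain_chart[OF N px(2)] .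
      define W where "W = {z \<in> {z \<in> U. P z \<in> fst c}. snd c (P z) \<in> local_dom c d f}"
      note dom = domain_local_dom[OF M c(1) N d(1) fD(1)]
      have W: "domain n W" unfolding W_def
        by (rule domain_preimage[OF P(5)[OF c(1)] smooth_map_continuous[OF P(4)[OF c(1)] domain_subset[OF P(5)[OF c(1)]]]
            smooth_mapD(1)[OF P(4)[OF c(1)]] dom])
      have "smooth_map n W (mdim N) (\<lambda>z. local_rep c d f (snd c (P z)))"
        by (rule smooth_map_compose[OF smooth_map_subset[OF P(4)[OF c(1)]] W _ dom fD(2)[OF c(1) d(1)]])
          (auto simp: W_def)
      then have "smooth_map n W (mdim N) (\<lambda>z. snd d (compose U f P z))"
        by (rule smooth_map_cong[OF W, rotated]) (simp add: W_def compose_def local_rep_chart[OF M c(1)])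
      moreover have "f (P z) \<in> fst d" if "z \<in> W" for z
        using that chart_mem_local_dom[OF M c(1), of "P z" d f] unfolding W_def by blast
      moreover have "x \<in> W"
        using x c d by (auto simp: W_def local_dom_def)
      ultimately show "\<exists>W d. domain n W \<and> x \<in> W \<and> W \<subseteq> U \<and> d \<in> atlas N \<and> compose U f P ` W \<subseteq> fst d \<and>
          smooth_map n W (mdim N) (\<lambda>z. snd d (compose U f P z))"
        using W d by (intro exI[of _ W] exI[of _ d]) (auto simp: W_def compose_def)
    qed
  qed
next
  assume fs: "dsmooth (standard_diff M) (standard_diff N) f"
  define R where "R c = compose (chart_image c) f (restrict (chart_inv c) (chart_image c))" for c :: "'a chart"
  have R: "R c y = f (chart_inv c y)" if "y \<in> chart_image c" for c y
    using that by (simp add: R_def compose_def)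
  have plot: "(mdim M, chart_image c, R c) \<in> plots (standard_diff N)" if "c \<in> atlas M" for c
    using fs chart_inv_plot[OF M that] unfolding dsmooth_def R_def by blast
  show "smooth_manifold_map M N f"
    unfolding smooth_manifold_map_def
  proof (intro conjI ballI)
    show "continuous_map (mtop M) (mtop N) f"
      unfolding continuous_map_def
    proof (intro conjI allI impI f)
      fix T assume T: "openin (mtop N) T"
      show "openin (mtop M) {p \<in> topspace (mtop M). f p \<in> T}"
      proof (subst openin_subopen, intro ballI)
        fix p assume p: "p \<in> {p \<in> topspace (mtop M). f p \<in> T}"
        then obtain c where c: "c \<in> atlas M" "p \<in> fst c" using obtain_chart[OF M] by blast
        note Rc = plotD[OF N plot[OF c(1)]]
        have "openin (mtop M) {q \<in> fst c. snd c q \<in> {y \<in> chart_image c. R c y \<in> T}}"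
          by (rule chart_preimage_open[OF M c(1) domain_preimage_map[OF Rc(1,3) T]])
        moreover have "{q \<in> fst c. snd c q \<in> {y \<in> chart_image c. R c y \<in> T}} = {q \<in> fst c. f q \<in> T}"
          using R[of _ c] chart_inv_chart[OF M c(1)] by (intro Collect_cong conj_cong refl) simp
        ultimately show "\<exists>S. openin (mtop M) S \<and> p \<in> S \<and> S \<subseteq> {p \<in> topspace (mtop M). f p \<in> T}"
          using p c chart_subset[OF M c(1)] by (intro exI[of _ "{q \<in> fst c. f q \<in> T}"]) auto
      qed
    qed
    fix c d assume c: "c \<in> atlas M" and d: "d \<in> atlas N"
    note Rc = plotD[OF N plot[OF c]]
    have eq: "{y \<in> chart_image c. R c y \<in> fst d} = local_dom c d f"
      unfolding local_dom_eq[OF M c] by (intro Collect_cong conj_cong refl) (simp only: R)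
    show "smooth_map (mdim M) (local_dom c d f) (mdim N) (local_rep c d f)"
    proof (rule smooth_map_cong[OF _ _ Rc(4)[OF d, unfolded eq]])
      show "domain (mdim M) (local_dom c d f)" using Rc(5)[OF d] by (simp only: eq)
      show "snd d (R c y) = local_rep c d f y" if "y \<in> local_dom c d f" for y
        using that R[of y c] unfolding local_rep_eq local_dom_eq[OF M c] by simp
    qed
  qed
qed


section \<open>Immersions in charts\<close>

text \<open>With identity maps inserted, this one chain rule also describes the effect of changing
  charts in the source or in the target.\<close>

lemma jacobian_local_rep_compose:
  assumes M: "smooth_manifold M" and N: "smooth_manifold N" and R: "smooth_manifold R"
    and f: "smooth_manifold_map M N f" and g: "smooth_manifold_map N R g"
    and c: "c \<in> charts_at M p" and d: "d \<in> charts_at N (f p)" and e: "e \<in> charts_at R (g (f p))"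
  shows "jacobian (mdim M) (mdim R) (local_rep c e (\<lambda>p. g (f p))) (snd c p) v =
    jacobian (mdim N) (mdim R) (local_rep d e g) (snd d (f p))
      (jacobian (mdim M) (mdim N) (local_rep c d f) (snd c p) v)"
proof -
  have c': "c \<in> atlas M" "p \<in> fst c" and d': "d \<in> atlas N" "f p \<in> fst d" and e': "e \<in> atlas R" "g (f p) \<in> fst e"
    using c d e by (auto simp: charts_at_def)
  note fD = smooth_manifold_mapD[OF f] and gD = smooth_manifold_mapD[OF g]
  have dom: "domain (mdim M) (local_dom c d f)" "domain (mdim N) (local_dom d e g)"
    using domain_local_dom[OF M c'(1) N d'(1) fD(1)] domain_local_dom[OF N d'(1) R e'(1) gD(1)] by auto
  note fs = fD(2)[OF c'(1) d'(1)]
  define V where "V = {y \<in> local_dom c d f. local_rep c d f y \<in> local_dom d e g}"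
  have V: "domain (mdim M) V" unfolding V_def
    by (rule domain_preimage[OF dom(1) smooth_map_continuous[OF fs domain_subset[OF dom(1)]] smooth_mapD(1)[OF fs] dom(2)])
  have rep: "local_rep c d f (snd c p) = snd d (f p)" by (rule local_rep_chart[OF M c'])
  have pV: "snd c p \<in> V" using c' d' e' rep by (auto simp: V_def local_dom_def)
  have "local_rep c e (\<lambda>p. g (f p)) y = local_rep d e g (local_rep c d f y)" if "y \<in> V" for y
  proof -
    have "f (chart_inv c y) \<in> fst d" using that by (simp add: V_def local_dom_eq[OF M c'(1)])
    then show ?thesis by (simp add: local_rep_eq chart_inv_chart[OF N d'(1)])
  qed
  then have "jacobian (mdim M) (mdim R) (local_rep c e (\<lambda>p. g (f p))) (snd c p) v =
    jacobian (mdim M) (mdim R) (\<lambda>y. local_rep d e g (local_rep c d f y)) (snd c p) v"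
    by (rule jacobian_cong[OF V pV])
  also have "\<dots> = jacobian (mdim N) (mdim R) (local_rep d e g) (local_rep c d f (snd c p))
      (jacobian (mdim M) (mdim N) (local_rep c d f) (snd c p) v)"
    by (rule jacobian_compose[OF smooth_map_subset[OF fs] V _ dom(2) gD(2)[OF d'(1) e'(1)] pV]) (auto simp: V_def)
  finally show ?thesis by (simp add: rep)
qed

lemma jacobian_local_rep_id:
  assumes M: "smooth_manifold M" and c: "c \<in> charts_at M p" and v: "v \<in> Rn (mdim M)"
  shows "jacobian (mdim M) (mdim M) (local_rep c c (\<lambda>p. p)) (snd c p) v = v"
proof -
  have c': "c \<in> atlas M" "p \<in> fst c" using c by (auto simp: charts_at_def)
  have "jacobian (mdim M) (mdim M) (local_rep c c (\<lambda>p. p)) (snd c p) v =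
    jacobian (mdim M) (mdim M) (\<lambda>y. y) (snd c p) v"
    using c'(2) by (intro jacobian_cong[OF chart_domain[OF M c'(1)]]) (auto simp: local_rep_chart[OF M c'(1)])
  then show ?thesis by (simp add: jacobian_id[OF v])
qed

text \<open>A tangent vector is determined by its coordinates in one chart, and the differential is
  linear in them. The chart \<open>c\<close> is the one that \<open>differential\<close> selects,
  whereas \<open>d\<close> is arbitrary, since Jacobians of transition maps send 0 to 0.\<close>

lemma inj_on_differential_iff:
  assumes M: "smooth_manifold M" and N: "smooth_manifold N" and f: "smooth_manifold_map M N f"
    and p: "p \<in> topspace (mtop M)" and c: "c = (SOME c. c \<in> charts_at M p)" and d: "d \<in> charts_at N (f p)"
  shows "inj_on (differential M N f p) (tangent_space M p) \<longleftrightarrow>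
    (\<forall>v\<in>Rn (mdim M). jacobian (mdim M) (mdim N) (local_rep c d f) (snd c p) v = (\<lambda>_. 0) \<longrightarrow> v = (\<lambda>_. 0))"
    (is "?inj \<longleftrightarrow> ?ker")
proof -
  have "\<exists>c. c \<in> charts_at M p" using obtain_chart[OF M p] unfolding charts_at_def by blast
  then have c': "c \<in> charts_at M p" unfolding c by (rule someI_ex)
  have diff: "differential M N f p X e = jacobian (mdim M) (mdim N) (local_rep c e f) (snd c p) (X c)"
    if "e \<in> charts_at N (f p)" for X e
    using that by (simp add: differential_def c[symmetric] Let_def)
  show ?thesis
  proof
    assume inj: ?inj
    show ?ker
    proof (intro ballI impI)
      fix v assume v: "v \<in> Rn (mdim M)" "jacobian (mdim M) (mdim N) (local_rep c d f) (snd c p) v = (\<lambda>_. 0)"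
      \<comment> \<open>The tangent vector whose coordinates in \<open>c\<close> are
        \<open>v\<close>, transported to the other charts. It is compared with the zero vector
        \<open>O'\<close>.\<close>
      define X where "X = (\<lambda>e\<in>charts_at M p. jacobian (mdim M) (mdim M) (local_rep c e (\<lambda>p. p)) (snd c p) v)"
      define O' where "O' = (\<lambda>e\<in>charts_at M p. (\<lambda>_. 0) :: nat \<Rightarrow> real)"
      have Xc: "X c = v" using jacobian_local_rep_id[OF M c' v(1)] c' by (simp add: X_def)
      have X: "X \<in> tangent_space M p"
        unfolding tangent_space_def
      proof (intro CollectI conjI ballI)
        show "X \<in> charts_at M p \<rightarrow>\<^sub>E Rn (mdim M)" using jacobian_mem_Rn by (auto simp: X_def)
        fix e e' assume e: "e \<in> charts_at M p" "e' \<in> charts_at M p"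
        show "X e' = jacobian (mdim M) (mdim M) (local_rep e e' (\<lambda>p. p)) (snd e p) (X e)"
          using jacobian_local_rep_compose[OF M M M smooth_manifold_map_id[OF M] smooth_manifold_map_id[OF M] c' e] e
          by (simp add: X_def)
      qed
      have O': "O' \<in> tangent_space M p"
        unfolding tangent_space_def O'_def by (auto simp: jacobian_zero mem_Rn)
      have "differential M N f p X e = differential M N f p O' e" for e
      proof (cases "e \<in> charts_at N (f p)")
        case True
        have "jacobian (mdim M) (mdim N) (local_rep c e f) (snd c p) v = (\<lambda>_. 0)"
          using jacobian_local_rep_compose[OF M N N f smooth_manifold_map_id[OF N] c' d True, of v] v(2)
          by (simp add: jacobian_zero)
        then show ?thesis using diff[OF True] Xc c' by (simp add: O'_def jacobian_zero)
      qed (simp add: differential_def)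
      then have "differential M N f p X = differential M N f p O'" by (rule ext)
      then have "X = O'" using inj_onD[OF inj _ X O'] by blast
      then show "v = (\<lambda>_. 0)" using Xc c' by (simp add: O'_def)
    qed
  next
    assume ker: ?ker
    show ?inj
    proof (rule inj_onI)
      fix X Y assume X: "X \<in> tangent_space M p" and Y: "Y \<in> tangent_space M p"
        and eq: "differential M N f p X = differential M N f p Y"
      have E: "X c \<in> Rn (mdim M)" "Y c \<in> Rn (mdim M)"
        using X Y PiE_mem[OF _ c'] unfolding tangent_space_def by blast+
      \<comment> \<open>The difference is taken in the coordinates of \<open>c\<close>, because
        \<open>tangent_space\<close> is a mere set of coordinate families.\<close>
      have "jacobian (mdim M) (mdim N) (local_rep c d f) (snd c p) (\<lambda>i. X c i - Y c i) = (\<lambda>_. 0)"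
        using fun_cong[OF eq, of d] diff[OF d] by (simp add: jacobian_diff)
      moreover have "(\<lambda>i. X c i - Y c i) \<in> Rn (mdim M)" using E by (auto simp: mem_Rn)
      ultimately have "(\<lambda>i. X c i - Y c i) = (\<lambda>_. 0)" using ker by blast
      then have XY: "X c = Y c" by (auto simp: fun_eq_iff)
      show "X = Y"
      proof
        fix e show "X e = Y e"
        proof (cases "e \<in> charts_at M p")
          case True
          have "X e = jacobian (mdim M) (mdim M) (local_rep c e (\<lambda>p. p)) (snd c p) (X c)"
            "Y e = jacobian (mdim M) (mdim M) (local_rep c e (\<lambda>p. p)) (snd c p) (Y c)"
            using X Y c' True unfolding tangent_space_def by blast+
          then show ?thesis using XY by simp
        next
          case False
          have "X \<in> charts_at M p \<rightarrow>\<^sub>E Rn (mdim M)" "Y \<in> charts_at M p \<rightarrow>\<^sub>E Rn (mdim M)"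
            using X Y unfolding tangent_space_def by blast+
          from this[THEN PiE_arb, OF False] show ?thesis by simp
        qed
      qed
    qed
  qed
qed


section \<open>The two implications\<close>

text \<open>The section is defined also at those \<open>r\<close> near \<open>r0\<close> for which
  \<open>P r\<close> is not in the image of \<open>f\<close>; there its second component is merely
  some point of \<open>M\<close>.\<close>

lemma immersion_diffeological:
  assumes M: "smooth_manifold M" and N: "smooth_manifold N"
    and f: "f \<in> topspace (mtop M) \<rightarrow> topspace (mtop N)" and imm: "manifold_immersion M N f"
    and P: "(n, U, P) \<in> plots (standard_diff N)"
    and r0: "r0 \<in> U" and x0: "x0 \<in> topspace (mtop M)" and r0x0: "P r0 = f x0"
  shows "\<exists>S V \<rho>.
         dopen (pullback (domain_diff n U) P (standard_diff M) f) S \<and> (r0, x0) \<in> S \<and>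
         domain n V \<and> V \<subseteq> U \<and> fst ` S \<subseteq> V \<and>
         dsmooth (domain_diff n V) (product_diff (domain_diff n U) (standard_diff M)) \<rho> \<and>
         (\<forall>(r, x)\<in>S. \<rho> (fst (r, x)) = (r, x))"
proof -
  note PD = plotD[OF N P]
  have fs: "smooth_manifold_map M N f" using imm by (simp add: manifold_immersion_def)
  \<comment> \<open>The chart in which \<open>differential\<close> is computed, as
    \<open>inj_on_differential_iff\<close> requires.\<close>
  define c where "c = (SOME c. c \<in> charts_at M x0)"
  have "\<exists>c. c \<in> charts_at M x0" using obtain_chart[OF M x0] unfolding charts_at_def by blast
  then have "c \<in> charts_at M x0" unfolding c_def by (rule someI_ex)
  then have c: "c \<in> atlas M" "x0 \<in> fst c" by (simp_all add: charts_at_def)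
  have "f x0 \<in> topspace (mtop N)" using f x0 by auto
  then obtain d where d: "d \<in> atlas N" "f x0 \<in> fst d" using obtain_chart[OF N] by metis
  define F where "F = local_rep c d f"
  have F: "smooth_map (mdim M) (local_dom c d f) (mdim N) F"
    unfolding F_def by (rule smooth_manifold_mapD(2)[OF fs c(1) d(1)])
  have dom: "domain (mdim M) (local_dom c d f)"
    by (rule domain_local_dom[OF M c(1) N d(1) smooth_manifold_mapD(1)[OF fs]])
  have y0: "snd c x0 \<in> local_dom c d f" using chart_mem_local_dom[OF M c, of d f] d(2) by simp
  have ker: "v = (\<lambda>_. 0)"
    if "v \<in> Rn (mdim M)" "jacobian (mdim M) (mdim N) F (snd c x0) v = (\<lambda>_. 0)" for v
    using imm x0 that inj_on_differential_iff[OF M N fs x0 c_def, of d] d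
    by (auto simp: manifold_immersion_def charts_at_def F_def)
  from immersion_left_inverse_normalized[OF dom F y0 ker, of 0 "\<lambda>_. 0"]
  obtain B \<Omega> L where B: "domain (mdim M) B" "snd c x0 \<in> B" "B \<subseteq> local_dom c d f" and \<Omega>: "domain (mdim N) \<Omega>"
    and F\<Omega>: "F \<in> B \<rightarrow> \<Omega>" and L: "smooth_map (mdim N) \<Omega> (mdim M) L" "\<And>y. y \<in> B \<Longrightarrow> L (F y) = y"
    by auto
  note cD = chart_domain[OF M c(1)]
  \<comment> \<open>Restricts to points that \<open>L\<close> sends into the chart image, where the
    inverse chart may be applied.\<close>
  define \<Omega>' where "\<Omega>' = {w \<in> \<Omega>. L w \<in> chart_image c}"
  have \<Omega>': "domain (mdim N) \<Omega>'" unfolding \<Omega>'_def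
    by (rule domain_preimage[OF \<Omega> smooth_map_continuous[OF L(1) domain_subset[OF \<Omega>]] smooth_mapD(1)[OF L(1)] cD])
  define V where "V = {r \<in> {r \<in> U. P r \<in> fst d}. snd d (P r) \<in> \<Omega>'}"
  note Pd = PD(4,5)[OF d(1)]
  have V: "domain n V" unfolding V_def
    by (rule domain_preimage[OF Pd(2) smooth_map_continuous[OF Pd(1) domain_subset[OF Pd(2)]] smooth_mapD(1)[OF Pd(1)] \<Omega>'])
  have VU: "V \<subseteq> U" by (auto simp: V_def)
  define l where "l r = L (snd d (P r))" for r
  have l: "smooth_map n V (mdim M) l" "l \<in> V \<rightarrow> chart_image c"
    unfolding l_def
    by (rule smooth_map_compose[OF smooth_map_subset[OF Pd(1)] V _ \<Omega>' smooth_map_subset[OF L(1)]])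
      (auto simp: V_def \<Omega>'_def)
  define \<rho> where "\<rho> r = (r, chart_inv c (l r))" for r
  \<comment> \<open>\<open>f\<close> need not be globally injective: a value \<open>P r\<close> may
    also be taken far from \<open>x0\<close>. Confining \<open>x\<close> to \<open>O'\<close> leaves
    only the point that the left inverse recovers.\<close>
  define O' where "O' = {x \<in> fst c. snd c x \<in> B}"
  have O': "openin (mtop M) O'" unfolding O'_def by (rule chart_preimage_open[OF M c(1) B(1)])
  define S where "S = {(r, x). r \<in> V \<and> x \<in> O' \<and> P r = f x}"
  have Fx: "snd d (f x) \<in> \<Omega>" "L (snd d (f x)) = snd c x" "f x \<in> fst d" if "x \<in> O'" for x
  proof -
    have x: "x \<in> fst c" "snd c x \<in> B" using that by (auto simp: O'_def)
    have "F (snd c x) = snd d (f x)" unfolding F_def by (rule local_rep_chart[OF M c(1) x(1)])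
    then show "snd d (f x) \<in> \<Omega>" "L (snd d (f x)) = snd c x"
      using L(2)[OF x(2)] funcset_mem[OF F\<Omega> x(2)] by simp_all
    show "f x \<in> fst d" using chart_mem_local_dom[OF M c(1) x(1), of d f] B(3) x(2) by blast
  qed
  have x0O: "x0 \<in> O'" using c(2) B(2) by (simp add: O'_def)
  have "r0 \<in> V" using Fx[OF x0O] r0 r0x0 c(2) by (auto simp: V_def \<Omega>'_def)
  then have S0: "(r0, x0) \<in> S" using x0O r0x0 by (simp add: S_def)
  have \<rho>S: "\<rho> r = (r, x)" if "(r, x) \<in> S" for r x
  proof -
    have x: "x \<in> O'" "P r = f x" using that by (auto simp: S_def)
    then have "l r = snd c x" using Fx(2) by (simp add: l_def)
    moreover have "x \<in> fst c" using x(1) by (simp add: O'_def)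
    ultimately show ?thesis using chart_inv_chart[OF M c(1)] by (simp add: \<rho>_def)
  qed
  have ptsU: "points (domain_diff n U) = U" and ptsV: "points (domain_diff n V) = V"
    using points_domain_diff PD(1) V by auto
  have "dopen (pullback (domain_diff n U) P (standard_diff M) f) S"
    unfolding dopen_def
  proof (intro conjI)
    show "S \<subseteq> points (pullback (domain_diff n U) P (standard_diff M) f)"
      using VU chart_subset[OF M c(1)]
      by (auto simp: S_def O'_def pullback_def subspace_diff_def ptsU points_standard_diff)
    show "\<forall>(k, Z, Q)\<in>plots (pullback (domain_diff n U) P (standard_diff M) f). openin (Euclidean_space k) {z \<in> Z. Q z \<in> S}"
    proof clarify
      fix k Z Q assume "(k, Z, Q) \<in> plots (pullback (domain_diff n U) P (standard_diff M) f)"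
      then have Z: "domain k Z" and Q1: "(k, Z, compose Z fst Q) \<in> plots (domain_diff n U)"
        and Q2: "(k, Z, compose Z snd Q) \<in> plots (standard_diff M)"
        and Qp: "\<And>z. z \<in> Z \<Longrightarrow> P (fst (Q z)) = f (snd (Q z))"
        by (auto simp: pullback_def subspace_diff_def product_diff_def parametrizations_def image_subset_iff case_prod_unfold)
      from Q1 have Q1': "smooth_map k Z n (compose Z fst Q)" by (simp add: plots_domain_diff_iff[OF PD(1)])
      \<comment> \<open>Both components of a plot are continuous, and the equation in
        \<open>S\<close> holds along every plot of the pullback.\<close>
      have "domain k ({z \<in> Z. compose Z fst Q z \<in> V} \<inter> {z \<in> Z. compose Z snd Q z \<in> O'})"
        by (intro domain_Int domain_preimage_map[OF Z plotD(3)[OF M Q2] O']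
            domain_preimage[OF Z smooth_map_continuous[OF Q1' domain_subset[OF Z]] smooth_mapD(1)[OF Q1'] V])
      moreover have "{z \<in> Z. compose Z fst Q z \<in> V} \<inter> {z \<in> Z. compose Z snd Q z \<in> O'} = {z \<in> Z. Q z \<in> S}"
        using Qp by (auto simp: compose_def S_def case_prod_unfold)
      ultimately show "openin (Euclidean_space k) {z \<in> Z. Q z \<in> S}" by (simp add: domain_def)
    qed
  qed
  moreover have "dsmooth (domain_diff n V) (product_diff (domain_diff n U) (standard_diff M)) \<rho>"
    unfolding dsmooth_def
  proof (intro conjI)
    have \<rho>V: "\<rho> r \<in> U \<times> topspace (mtop M)" if "r \<in> V" for r
    proof -
      have "chart_inv c (l r) \<in> fst c" using l(2) that by (intro chart_inv_mem[OF M c(1)]) auto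
      then show ?thesis using that VU chart_subset[OF M c(1)] by (auto simp: \<rho>_def)
    qed
    then show "\<rho> \<in> points (domain_diff n V) \<rightarrow> points (product_diff (domain_diff n U) (standard_diff M))"
      by (auto simp: ptsV ptsU product_diff_def points_standard_diff)
    show "\<forall>(k, Z, Q)\<in>plots (domain_diff n V).
        (k, Z, compose Z \<rho> Q) \<in> plots (product_diff (domain_diff n U) (standard_diff M))"
    proof clarify
      fix k Z Q assume "(k, Z, Q) \<in> plots (domain_diff n V)"
      then have Z: "domain k Z" and Q: "Q \<in> Z \<rightarrow>\<^sub>E V" "smooth_map k Z n Q"
        by (simp_all add: plots_domain_diff_iff[OF V])
      have QV: "Q z \<in> V" if "z \<in> Z" for z using Q(1) that by auto
      have "(k, Z, compose Z (restrict (chart_inv c) (chart_image c)) (\<lambda>z. l (Q z))) \<in> plots (standard_diff M)"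
        by (rule plot_compose[OF M chart_inv_plot[OF M c(1)] Z])
          (use l(2) QV in blast, rule smooth_map_compose[OF Q(2) Z _ V l(1)], use QV in blast)
      moreover have "compose Z (restrict (chart_inv c) (chart_image c)) (\<lambda>z. l (Q z)) = compose Z snd (compose Z \<rho> Q)"
        using funcset_mem[OF l(2) QV] by (intro ext) (simp add: compose_def \<rho>_def)
      moreover have "compose Z fst (compose Z \<rho> Q) = Q"
        using PiE_arb[OF Q(1)] by (intro ext) (simp add: compose_def \<rho>_def)
      moreover have "(k, Z, Q) \<in> plots (domain_diff n U)"
        using Z Q VU unfolding plots_domain_diff_iff[OF PD(1)] by (auto simp: PiE_iff)
      moreover have "compose Z \<rho> Q \<in> Z \<rightarrow>\<^sub>E U \<times> topspace (mtop M)"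
        using \<rho>V QV by (simp add: compose_def PiE_iff)
      ultimately show "(k, Z, compose Z \<rho> Q) \<in> plots (product_diff (domain_diff n U) (standard_diff M))"
        using Z by (simp add: product_diff_def parametrizations_def ptsU points_standard_diff)
    qed
  qed
  moreover have "fst ` S \<subseteq> V" by (auto simp: S_def)
  moreover have "\<forall>(r, x)\<in>S. \<rho> (fst (r, x)) = (r, x)" using \<rho>S by auto
  ultimately show ?thesis using S0 V VU by blast
qed

text \<open>With an inverse chart at \<open>f p\<close> as the test plot, the second component of
  the section, read in \<open>c\<close>, is a smooth left inverse of the local representative near
  \<open>snd c p\<close>. The chain rule then excludes nonzero kernel vectors.\<close>

lemma diffeological_immersion_kernel:
  assumes M: "smooth_manifold M" and N: "smooth_manifold N" and fs: "smooth_manifold_map M N f"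
    and imm: "diffeological_immersion (standard_diff M) (standard_diff N) f"
    and c: "c \<in> charts_at M p" and d: "d \<in> charts_at N (f p)"
    and v: "v \<in> Rn (mdim M)" "jacobian (mdim M) (mdim N) (local_rep c d f) (snd c p) v = (\<lambda>_. 0)"
  shows "v = (\<lambda>_. 0)"
proof -
  have c': "c \<in> atlas M" "p \<in> fst c" and d': "d \<in> atlas N" "f p \<in> fst d"
    using c d by (auto simp: charts_at_def)
  define n where "n = mdim N"
  define U where "U = chart_image d"
  define P where "P = restrict (chart_inv d) U"
  have P: "(n, U, P) \<in> plots (standard_diff N)"
    unfolding n_def U_def P_def by (rule chart_inv_plot[OF N d'(1)])
  have U: "domain n U" unfolding n_def U_def by (rule chart_domain[OF N d'(1)])
  have Pd: "snd d q \<in> U" "P (snd d q) = q" if "q \<in> fst d" for q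
    using that chart_inv_chart[OF N d'(1)] by (auto simp: P_def U_def)
  let ?PB = "pullback (domain_diff n U) P (standard_diff M) f"
  have pts: "points ?PB = {(r, x). r \<in> U \<and> x \<in> topspace (mtop M) \<and> P r = f x}"
    by (simp add: pullback_def subspace_diff_def points_domain_diff[OF U] points_standard_diff)
  have pM: "p \<in> topspace (mtop M)" using chart_subset[OF M c'(1)] c'(2) by auto
  have pPB: "(snd d (f p), p) \<in> points ?PB" using pM Pd[OF d'(2)] by (simp add: pts)
  note imm' = imm[unfolded diffeological_immersion_def, THEN conjunct2, THEN conjunct2, THEN conjunct2]
  obtain S V \<rho> where S: "dopen ?PB S" "(snd d (f p), p) \<in> S"
    and V: "domain n V" "fst ` S \<subseteq> V"
    and \<rho>': "dsmooth (domain_diff n V) (product_diff (domain_diff n U) (standard_diff M)) \<rho>"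
      "\<forall>(r, x)\<in>S. \<rho> (fst (r, x)) = (r, x)"
    using bspec[OF bspec[OF imm' P, unfolded prod.case] pPB, unfolded prod.case] by blast
  have \<rho>: "\<rho> r = (r, x)" if "(r, x) \<in> S" for r x using \<rho>'(2) that by auto
  define F where "F = local_rep c d f"
  let ?D = "local_dom c d f"
  have F: "smooth_map (mdim M) ?D n F"
    unfolding F_def n_def by (rule smooth_manifold_mapD(2)[OF fs c'(1) d'(1)])
  have dom: "domain (mdim M) ?D"
    by (rule domain_local_dom[OF M c'(1) N d'(1) smooth_manifold_mapD(1)[OF fs]])
  have D: "y \<in> chart_image c" "f (chart_inv c y) \<in> fst d" "chart_inv c y \<in> fst c"
    "F y = snd d (f (chart_inv c y))" if "y \<in> ?D" for y
    using that chart_inv_mem[OF M c'(1)] by (auto simp: local_dom_eq[OF M c'(1)] F_def local_rep_eq)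
  \<comment> \<open>The graph of \<open>f\<close> over the chart, as a plot of the pullback. The
    preimage of the D-open set \<open>S\<close> under it is the open set \<open>C\<close> on which
    the section is known.\<close>
  define Q where "Q = (\<lambda>y\<in>?D. (F y, chart_inv c y))"
  have FU: "F y \<in> U" "P (F y) = f (chart_inv c y)" if "y \<in> ?D" for y
    using D[OF that] Pd by auto
  have Q: "(mdim M, ?D, Q) \<in> plots ?PB"
  proof -
    have "(mdim M, ?D, restrict F ?D) \<in> plots (domain_diff n U)"
      unfolding plots_domain_diff_iff[OF U] using dom FU(1) smooth_map_cong[OF dom _ F, of "restrict F ?D"] by auto
    moreover have "compose ?D fst Q = restrict F ?D" by (auto simp: compose_def Q_def fun_eq_iff)
    moreover have "(mdim M, ?D, compose ?D (restrict (chart_inv c) (chart_image c)) (\<lambda>y. y)) \<in> plots (standard_diff M)"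
      by (rule plot_compose[OF M chart_inv_plot[OF M c'(1)] dom _ smooth_map_id[OF dom]]) (use D(1) in blast)
    moreover have "compose ?D (restrict (chart_inv c) (chart_image c)) (\<lambda>y. y) = compose ?D snd Q"
      using D(1) by (auto simp: compose_def Q_def fun_eq_iff)
    moreover have "chart_inv c y \<in> topspace (mtop M)" if "y \<in> ?D" for y
      using D(3)[OF that] chart_subset[OF M c'(1)] by auto
    ultimately show ?thesis
      using dom FU by (auto simp: pullback_def subspace_diff_def product_diff_def parametrizations_def
          points_domain_diff[OF U] points_standard_diff Q_def)
  qed
  define C where "C = {y \<in> ?D. Q y \<in> S}"
  have C: "domain (mdim M) C" using S(1) Q unfolding dopen_def C_def domain_def by blast
  have CD: "C \<subseteq> ?D" by (auto simp: C_def)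
  have \<rho>C: "F y \<in> V" "snd (\<rho> (F y)) = chart_inv c y" if "y \<in> C" for y
  proof -
    have "y \<in> ?D" "Q y \<in> S" using that unfolding C_def by blast+
    then have *: "(F y, chart_inv c y) \<in> S" unfolding Q_def by simp
    then show "F y \<in> V" using V(2) by force
    show "snd (\<rho> (F y)) = chart_inv c y" using \<rho>[OF *] by simp
  qed
  have p0: "snd c p \<in> ?D" using chart_mem_local_dom[OF M c', of d f] d'(2) by simp
  have Fp: "F (snd c p) = snd d (f p)" unfolding F_def by (rule local_rep_chart[OF M c'])
  have pC: "snd c p \<in> C"
    using p0 S(2) chart_inv_chart[OF M c'] by (simp add: C_def Q_def Fp)
  \<comment> \<open>The identity of \<open>V\<close> is a plot of \<open>V\<close>, so smoothness of
    \<open>\<rho>\<close> makes \<open>\<rho>\<close> itself a plot of the product, and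
    \<open>h\<close> is its component in \<open>M\<close>.\<close>
  define h where "h = compose V snd (compose V \<rho> (\<lambda>r\<in>V. r))"
  have "(n, V, \<lambda>r\<in>V. r) \<in> plots (domain_diff n V)"
    unfolding plots_domain_diff_iff[OF V(1)]
    using V(1) smooth_map_cong[OF V(1) _ smooth_map_id[OF V(1)], of "\<lambda>r\<in>V. r"] by auto
  then have "(n, V, compose V \<rho> (\<lambda>r\<in>V. r)) \<in> plots (product_diff (domain_diff n U) (standard_diff M))"
    using \<rho>'(1) unfolding dsmooth_def by blast
  then have h: "(n, V, h) \<in> plots (standard_diff M)"
    by (simp add: product_diff_def h_def)
  have hr: "h r = snd (\<rho> r)" if "r \<in> V" for r using that by (simp add: h_def compose_def)
  note hD = plotD(4,5)[OF M h c'(1)]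
  have FC: "F \<in> C \<rightarrow> {r \<in> V. h r \<in> fst c}"
    using \<rho>C hr D(3) CD by auto
  have "v = jacobian (mdim M) (mdim M) (\<lambda>y. y) (snd c p) v" using jacobian_id[OF v(1)] by simp
  also have "\<dots> = jacobian (mdim M) (mdim M) (\<lambda>y. snd c (h (F y))) (snd c p) v"
  proof (rule jacobian_cong[OF C pC])
    fix y assume y: "y \<in> C"
    then have "y \<in> chart_image c" using D(1) CD by blast
    then show "y = snd c (h (F y))" using \<rho>C[OF y] hr chart_chart_inv[OF M c'(1)] by simp
  qed
  also have "\<dots> = jacobian n (mdim M) (\<lambda>r. snd c (h r)) (F (snd c p)) (jacobian (mdim M) n F (snd c p) v)"
    by (rule jacobian_compose[OF smooth_map_subset[OF F CD] C FC hD(2,1) pC])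
  also have "\<dots> = (\<lambda>_. 0)" using v(2) by (simp add: F_def n_def jacobian_zero)
  finally show ?thesis .
qed

theorem corollary4p18:
  fixes M :: "'a manifold" and N :: "'b manifold" and f :: "'a \<Rightarrow> 'b"
  assumes "smooth_manifold M" and "smooth_manifold N"
    and "f \<in> topspace (mtop M) \<rightarrow> topspace (mtop N)"
  shows "diffeological_immersion (standard_diff M) (standard_diff N) f \<longleftrightarrow> manifold_immersion M N f"
proof
  note M = assms(1) and N = assms(2)
  note smooth_iff = dsmooth_iff_smooth_manifold_map[OF assms]
  {
    assume imm: "diffeological_immersion (standard_diff M) (standard_diff N) f"
    then have fs: "smooth_manifold_map M N f"
      using smooth_iff by (simp add: diffeological_immersion_def)
    have "inj_on (differential M N f p) (tangent_space M p)" if p: "p \<in> topspace (mtop M)" for p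
    proof -
      define c where "c = (SOME c. c \<in> charts_at M p)"
      have "\<exists>c. c \<in> charts_at M p" using obtain_chart[OF M p] unfolding charts_at_def by blast
      then have c: "c \<in> charts_at M p" unfolding c_def by (rule someI_ex)
      have "f p \<in> topspace (mtop N)" using assms(3) p by auto
      then obtain d where d: "d \<in> charts_at N (f p)"
        using obtain_chart[OF N] unfolding charts_at_def by blast
      show ?thesis
        using inj_on_differential_iff[OF M N fs p c_def d] diffeological_immersion_kernel[OF M N fs imm c d]
        by blast
    qed
    then show "manifold_immersion M N f" using fs by (simp add: manifold_immersion_def)
  }
  assume imm: "manifold_immersion M N f"
  then have dsmooth: "dsmooth (standard_diff M) (standard_diff N) f"
    using smooth_iff by (simp add: manifold_immersion_def)
  show "diffeological_immersion (standard_diff M) (standard_diff N) f"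
    unfolding diffeological_immersion_def
  proof (intro conjI dsmooth diffeological_space_standard_diff M N, clarify)
    fix n U P r0 x0
    assume P: "(n, U, P) \<in> plots (standard_diff N)"
      and rx: "(r0, x0) \<in> points (pullback (domain_diff n U) P (standard_diff M) f)"
    have "r0 \<in> U" "x0 \<in> topspace (mtop M)" "P r0 = f x0"
      using rx points_domain_diff[OF plotD(1)[OF N P]]
      by (simp_all add: pullback_def subspace_diff_def points_standard_diff)
    from immersion_diffeological[OF assms imm P this]
    show "\<exists>S V \<rho>.
         dopen (pullback (domain_diff n U) P (standard_diff M) f) S \<and> (r0, x0) \<in> S \<and>
         domain n V \<and> V \<subseteq> U \<and> fst ` S \<subseteq> V \<and>
         dsmooth (domain_diff n V) (product_diff (domain_diff n U) (standard_diff M)) \<rho> \<and>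
         (\<forall>(r, x)\<in>S. \<rho> (fst (r, x)) = (r, x))" .
  qed
qed

end
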